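(* For every integer $k \geq 1$, ${\delta_{\text{poly-rem}}}(C_{2k+1}) = \frac{1}{2k+1}$, where $C_{2k+1}$ is the cycle of length $2k+1$.
   Context: All graphs are finite and simple; "copies" of a fixed graph $H$ in a graph $G$ are labeled copies, i.e. injective maps $V(H)\to V(G)$ sending edges to edges; $\delta(G)$ denotes the minimum degree of $G$. For a graph $H$, $\varepsilon>0$ and $\gamma\in[0,1]$, let $\delta(\varepsilon,H;\gamma)$ be the maximum $\delta\in[0,1]$ such that every $n$-vertex graph $G$ with minimum degree at least $\gamma n$ which contains $\varepsilon n^2$ edge-disjoint copies of $H$ contains at least $\delta n^{v(H)}$ copies of $H$. The polynomial removal threshold ${\delta_{\text{poly-rem}}}(H)$ is the infimum of those $\gamma$ for which there exists $\mu=\mu(\gamma)>0$ such that $\delta(\varepsilon,H;\gamma)\geq \mu\varepsilon^{1/\mu}$ for all $\varepsilon>0$.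
   Formalization: In the definition of the threshold, ε ranges over (0,1] instead of all ε>0: since δ(ε,H;γ) ≤ 1 while με^{1/μ} is unbounded in ε, no γ would qualify otherwise; for ε>1 no graph meets the hypothesis. *)

theory Defs
  imports Complex_Main "HOL-Library.FuncSet"
begin

type_synonym 'a graph = "'a set \<times> 'a set set"

abbreviation verts :: "'a graph \<Rightarrow> 'a set" where
  "verts G \<equiv> fst G"

abbreviation edges :: "'a graph \<Rightarrow> 'a set set" where
  "edges G \<equiv> snd G"

definition finite_simple_graph :: "'a graph \<Rightarrow> bool" where
  "finite_simple_graph G \<longleftrightarrow> finite (verts G) \<and> (\<forall>e \<in> edges G. e \<subseteq> verts G \<and> card e = 2)"

definition degree :: "'a graph \<Rightarrow> 'a \<Rightarrow> nat" where
  "degree G v = card {e \<in> edges G. v \<in> e}"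

definition min_degree :: "'a graph \<Rightarrow> nat" where
  "min_degree G = Min (degree G ` verts G)"

definition cycle_graph :: "nat \<Rightarrow> nat graph" where
  "cycle_graph m = ({0..<m}, {{i, (i + 1) mod m} | i. i < m})"

text \<open>Labeled copies are taken extensional outside \<open>verts H\<close>, so that \<open>card (copies H G)\<close>
  counts maps from \<open>verts H\<close> to \<open>verts G\<close>.\<close>

definition copies :: "'a graph \<Rightarrow> 'b graph \<Rightarrow> ('a \<Rightarrow> 'b) set" where
  "copies H G = {f \<in> verts H \<rightarrow>\<^sub>E verts G. inj_on f (verts H) \<and> (\<forall>e \<in> edges H. f ` e \<in> edges G)}"

definition copy_edges :: "'a graph \<Rightarrow> ('a \<Rightarrow> 'b) \<Rightarrow> 'b set set" where
  "copy_edges H f = (\<lambda>e. f ` e) ` edges H"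

definition edge_disjoint_copies :: "'a graph \<Rightarrow> 'b graph \<Rightarrow> ('a \<Rightarrow> 'b) set \<Rightarrow> bool" where
  "edge_disjoint_copies H G C \<longleftrightarrow>
     C \<subseteq> copies H G \<and> pairwise (\<lambda>f g. copy_edges H f \<inter> copy_edges H g = {}) C"

text \<open>Host graphs range over graphs with vertices in \<open>nat\<close>: every finite graph is isomorphic
  to one of these. They are required to be nonempty so that the minimum degree is defined.\<close>

definition removal_bound :: "real \<Rightarrow> 'a graph \<Rightarrow> real \<Rightarrow> real \<Rightarrow> bool" where
  "removal_bound \<epsilon> H \<gamma> \<delta> \<longleftrightarrow>
     (\<forall>G :: nat graph. \<forall>n.
        finite_simple_graph G \<and> card (verts G) = n \<and> n \<ge> 1 \<and>
        real (min_degree G) \<ge> \<gamma> * real n \<and>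
        (\<exists>C. edge_disjoint_copies H G C \<and> real (card C) \<ge> \<epsilon> * (real n)\<^sup>2) \<longrightarrow>
        real (card (copies H G)) \<ge> \<delta> * real n ^ card (verts H))"

definition removal_delta :: "real \<Rightarrow> 'a graph \<Rightarrow> real \<Rightarrow> real" where
  "removal_delta \<epsilon> H \<gamma> = (GREATEST \<delta>. \<delta> \<in> {0..1} \<and> removal_bound \<epsilon> H \<gamma> \<delta>)"

text \<open>The maximum is attained, so \<open>GREATEST\<close> is meaningful.\<close>

lemma removal_delta_is_max:
  shows "removal_delta \<epsilon> H \<gamma> \<in> {0..1}" (is ?A)
    and "removal_bound \<epsilon> H \<gamma> (removal_delta \<epsilon> H \<gamma>)" (is ?B)
    and "\<And>\<delta>. \<lbrakk>\<delta> \<in> {0..1}; removal_bound \<epsilon> H \<gamma> \<delta>\<rbrakk> \<Longrightarrow> \<delta> \<le> removal_delta \<epsilon> H \<gamma>"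
proof -
  let ?S = "{\<delta>. \<delta> \<in> {0..1} \<and> removal_bound \<epsilon> H \<gamma> \<delta>}"
  define s where "s = Sup ?S"
  have zero: "0 \<in> ?S" by (simp add: removal_bound_def)
  have bdd: "bdd_above ?S" by (rule bdd_aboveI[of _ 1]) auto
  have upper: "\<delta> \<le> s" if "\<delta> \<in> ?S" for \<delta>
    unfolding s_def by (rule cSup_upper[OF that bdd])
  have least: "s \<le> b" if "\<And>\<delta>. \<delta> \<in> ?S \<Longrightarrow> \<delta> \<le> b" for b
    unfolding s_def by (rule cSup_least) (use zero that in blast)+
  have s01: "s \<in> {0..1}" using upper[OF zero] least[of 1] by auto
  have "removal_bound \<epsilon> H \<gamma> s"
    unfolding removal_bound_def
  proof (intro allI impI)
    fix G :: "nat graph" and n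
    assume G: "finite_simple_graph G \<and> card (verts G) = n \<and> n \<ge> 1 \<and>
        real (min_degree G) \<ge> \<gamma> * real n \<and>
        (\<exists>C. edge_disjoint_copies H G C \<and> real (card C) \<ge> \<epsilon> * (real n)\<^sup>2)"
    have pos: "real n ^ card (verts H) > 0" using G by simp
    have "s \<le> real (card (copies H G)) / real n ^ card (verts H)"
    proof (rule least)
      fix \<delta> assume "\<delta> \<in> ?S"
      then have "removal_bound \<epsilon> H \<gamma> \<delta>" by simp
      then have "\<delta> * real n ^ card (verts H) \<le> real (card (copies H G))"
        using G unfolding removal_bound_def by blast
      then show "\<delta> \<le> real (card (copies H G)) / real n ^ card (verts H)"
        using pos by (simp add: pos_le_divide_eq)
    qed
    then show "s * real n ^ card (verts H) \<le> real (card (copies H G))"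
      using pos by (simp add: pos_le_divide_eq)
  qed
  with s01 upper have eq: "removal_delta \<epsilon> H \<gamma> = s"
    unfolding removal_delta_def by (intro Greatest_equality) auto
  show ?A ?B using eq s01 \<open>removal_bound \<epsilon> H \<gamma> s\<close> by auto
  show "\<delta> \<le> removal_delta \<epsilon> H \<gamma>" if "\<delta> \<in> {0..1}" "removal_bound \<epsilon> H \<gamma> \<delta>" for \<delta>
    using upper that eq by auto
qed

text \<open>The range of \<open>\<epsilon>\<close> is \<open>(0,1]\<close>: no nonempty graph on \<open>n\<close> vertices contains more than \<open>n\<^sup>2\<close>
  edge-disjoint copies of a graph with an edge, while \<open>\<mu> * \<epsilon> powr (1 / \<mu>)\<close> is unbounded as
  \<open>\<epsilon> \<rightarrow> \<infinity>\<close> although \<open>removal_delta\<close> is at most 1. With unrestricted \<open>\<epsilon>\<close> no \<open>\<gamma>\<close> would qualify.\<close>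

definition poly_removal_threshold :: "'a graph \<Rightarrow> real" where
  "poly_removal_threshold H =
     Inf {\<gamma> \<in> {0..1}. \<exists>\<mu>>0. \<forall>\<epsilon>. 0 < \<epsilon> \<and> \<epsilon> \<le> 1 \<longrightarrow>
            removal_delta \<epsilon> H \<gamma> \<ge> \<mu> * \<epsilon> powr (1 / \<mu>)}"

end

theory Submission
  imports Defs
begin

text \<open>
  Put \<open>m = 2k + 1\<close>.

  Above \<open>1 / m\<close>: sample \<open>l = O(log (1 / \<epsilon>))\<close> vertices. All but a small multiple of \<open>\<epsilon> n\<close> vertices
  are adjacent to more than \<open>l / m\<close> of the samples, so on every cycle through such vertices only,
  two vertices share a sampled neighbour. A vertex has only \<open>2 ^ l\<close> possible traces on the sample,
  which is polynomial in \<open>1 / \<epsilon>\<close>, so polynomially many of the edge-disjoint cycles have the same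
  traces; they supply polynomially many walks of length \<open>m - 2\<close> between two positions, all of which
  close up to walks of length \<open>m\<close> through one and the same sampled vertex. If few vertices were on
  that many closed walks, a random sample would avoid them all.

  Below \<open>1 / m\<close>: a Behrend-type set yields a graph in which many edge-disjoint \<open>m\<close>-cycles are
  almost the only ones. Joining its parts to the parts of a blown-up path on \<open>m\<close> vertices raises the
  minimum degree to almost \<open>n / m\<close> without creating a further \<open>m\<close>-cycle.
\<close>

section \<open>Sampling\<close>

text \<open>The value \<open>1 / m\<close> is a pigeonhole bound: \<open>m\<close> subsets of an
  \<open>l\<close>-set with more than \<open>l / m\<close> elements each cannot be pairwise
  disjoint. Which two positions share a sampled neighbour depends on the cycle, hence the
  restriction to cycles with equal traces; with \<open>l\<close> logarithmic, the
  \<open>(2 ^ l) ^ m\<close> trace patterns cost only a power of \<open>\<epsilon>\<close>.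
  Edge-disjointness enters because a cycle of the family is fixed by its vertices at two adjacent
  positions, so many cycles through one vertex reach many vertices next to it. The walks obtained
  may repeat vertices; therefore closed walks are counted, and the degenerate ones are subtracted at
  the end. In the other direction, the dimension \<open>d\<close> of the Behrend-type set is fixed
  and its side \<open>q\<close> grows. The planted cycles have density at least of order
  \<open>1 / q ^ 2\<close>, whereas \<open>n\<close> is at least \<open>q ^ d\<close> and there are
  at most \<open>n ^ 2\<close> copies in all. Hence a polynomial bound of any given degree fails
  once \<open>d\<close> is large enough. The added vertices must not help an odd closed walk to go
  around the columns, which is why they form a path of columns and not a cycle.\<close>

lemma card_eq_sum_fibres:
  assumes "finite F" "finite T" "g ` F \<subseteq> T"
  shows "card F = (\<Sum>y\<in>T. card {f \<in> F. g f = y})"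
  using sum.group[OF assms, of "\<lambda>_. 1::nat"] by simp

lemma ex_large_fibre:
  assumes "finite F" "finite T" "T \<noteq> {}" "g ` F \<subseteq> T"
  shows "\<exists>y\<in>T. card F \<le> card T * card {f \<in> F. g f = y}"
proof (rule ccontr)
  assume "\<not> ?thesis"
  then have less: "card T * card {f \<in> F. g f = y} < card F" if "y \<in> T" for y
    using that by force
  have "card T * card F = (\<Sum>y\<in>T. card T * card {f \<in> F. g f = y})"
    using card_eq_sum_fibres[OF assms(1,2,4)] by (simp add: sum_distrib_left)
  also have "\<dots> < (\<Sum>y\<in>T. card F)"
    using assms less by (intro sum_strict_mono) auto
  finally show False by simp
qed

text \<open>At \<open>z = 1\<close> the curve \<open>1 - \<gamma> + \<gamma> * z ^ m\<close> meets
  the diagonal with slope \<open>\<gamma> * m > 1\<close>, so slightly to the left it runs below the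
  diagonal; \<open>r\<close> is the ratio at such a point. In the moment bound the curve is the mean
  weight of one sampled vertex and \<open>z\<close> its share of the threshold weight
  \<open>z ^ l\<close>, so \<open>r\<close> becomes the base of the exponential decay.\<close>

lemma ex_decreasing_chord:
  fixes \<gamma> :: real
  assumes "\<gamma> * real m > 1" "\<gamma> \<le> 1"
  shows "\<exists>z r. 0 < z \<and> z < 1 \<and> 0 < r \<and> r < 1 \<and> 1 - \<gamma> + \<gamma> * z ^ m \<le> r * z"
proof -
  define f where "f = (\<lambda>z::real. \<gamma> * z ^ m - z)"
  have "DERIV f 1 :> \<gamma> * real m - 1"
    unfolding f_def by (auto intro!: derivative_eq_intros)
  from DERIV_pos_inc_left[OF this] assms obtain d where
    d: "d > 0" "\<And>h. h > 0 \<Longrightarrow> h < d \<Longrightarrow> f (1 - h) < f 1" by auto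
  define z where "z = 1 - min (d / 2) (1 / 2)"
  have z: "0 < z" "z < 1" using d(1) by (auto simp: z_def)
  have "f z < f 1" unfolding z_def using d(1) by (intro d(2)) auto
  then have lt: "1 - \<gamma> + \<gamma> * z ^ m < z" by (simp add: f_def)
  have "\<gamma> > 0"
  proof (rule ccontr)
    assume "\<not> ?thesis"
    then have "\<gamma> * real m \<le> 0" by (intro mult_nonpos_nonneg) auto
    with assms(1) show False by simp
  qed
  then have pos: "1 - \<gamma> + \<gamma> * z ^ m > 0" using assms(2) z by (simp add: add_nonneg_pos)
  show ?thesis
    using z pos lt by (intro exI[of _ z] exI[of _ "(1 - \<gamma> + \<gamma> * z ^ m) / z"]) auto
qed

text \<open>The exponential moment method: a sample with few hits has weight at least \<open>z ^ l\<close> under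
  the product weight that gives \<open>z ^ m\<close> to every hit.\<close>

lemma card_samples_with_few_hits:
  fixes \<gamma> z r :: real
  assumes V: "finite V" and N: "N \<subseteq> V" "real (card N) \<ge> \<gamma> * real (card V)"
    and z: "0 < z" "z < 1" and r: "1 - \<gamma> + \<gamma> * z ^ m \<le> r * z"
  shows "real (card {X \<in> {..<l} \<rightarrow>\<^sub>E V. m * card {i. i < l \<and> X i \<in> N} \<le> l})
           \<le> (r * real (card V)) ^ l"
proof -
  let ?P = "{..<l} \<rightarrow>\<^sub>E V"
  let ?Bad = "{X \<in> ?P. m * card {i. i < l \<and> X i \<in> N} \<le> l}"
  let ?w = "\<lambda>x. if x \<in> N then z ^ m else 1"
  have fin: "finite ?P" using V by (intro finite_PiE) auto
  have w: "(\<Prod>i<l. ?w (X i)) = z ^ (m * card {i. i < l \<and> X i \<in> N})" for X :: "nat \<Rightarrow> 'a"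
  proof -
    have "(\<Prod>i<l. ?w (X i)) = (\<Prod>i\<in>{i\<in>{..<l}. X i \<in> N}. z ^ m)"
      by (subst prod.inter_filter) auto
    then show ?thesis by (simp add: power_mult)
  qed
  have "real (card ?Bad) * z ^ l = (\<Sum>X\<in>?Bad. z ^ l)" by simp
  also have "\<dots> \<le> (\<Sum>X\<in>?Bad. \<Prod>i<l. ?w (X i))"
    unfolding w using z by (intro sum_mono power_decreasing) auto
  also have "\<dots> \<le> (\<Sum>X\<in>?P. \<Prod>i<l. ?w (X i))"
    unfolding w using fin z by (intro sum_mono2) auto
  also have "\<dots> = (\<Sum>x\<in>V. ?w x) ^ l"
    using V by (subst prod_sum_PiE[symmetric]) auto
  also have "(\<Sum>x\<in>V. ?w x) = real (card N) * z ^ m + real (card (V - N))"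
    using V N(1) finite_subset[OF N(1) V]
    by (subst sum.If_cases) (auto simp: Int_absorb1 Diff_eq[symmetric])
  also have "\<dots> = real (card V) - real (card N) * (1 - z ^ m)"
    using V N(1) by (simp add: card_Diff_subset finite_subset of_nat_diff card_mono algebra_simps)
  also have "\<dots> ^ l \<le> (r * real (card V) * z) ^ l"
  proof (rule power_mono)
    have "\<gamma> * real (card V) * (1 - z ^ m) \<le> real (card N) * (1 - z ^ m)"
      using N(2) z by (intro mult_right_mono) (auto simp: power_le_one)
    moreover have "(1 - \<gamma> + \<gamma> * z ^ m) * real (card V) \<le> r * z * real (card V)"
      using r by (intro mult_right_mono) auto
    ultimately show "real (card V) - real (card N) * (1 - z ^ m) \<le> r * real (card V) * z"
      by (simp add: algebra_simps)
    have "real (card N) * (1 - z ^ m) \<le> real (card V) * 1"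
      using z V N(1) by (intro mult_mono) (auto intro: card_mono simp: power_le_one)
    then show "0 \<le> real (card V) - real (card N) * (1 - z ^ m)" by simp
  qed
  finally have "real (card ?Bad) * z ^ l \<le> (r * real (card V)) ^ l * z ^ l"
    by (simp add: power_mult_distrib)
  then show ?thesis using z by simp
qed

lemma card_samples_hitting:
  assumes V: "finite V" and R: "R \<subseteq> V" and l: "l \<ge> 1"
  shows "card {X \<in> {..<l} \<rightarrow>\<^sub>E V. \<exists>i<l. X i \<in> R} \<le> l * (card R * card V ^ (l - 1))"
proof -
  have one: "card {X \<in> {..<l} \<rightarrow>\<^sub>E V. X i \<in> R} \<le> card R * card V ^ (l - 1)" if i: "i < l" for i
  proof -
    let ?B = "\<lambda>j. if j = i then R else V"
    have "{X \<in> {..<l} \<rightarrow>\<^sub>E V. X i \<in> R} \<subseteq> PiE {..<l} ?B"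
      by (auto simp: PiE_iff extensional_def)
    then have "card {X \<in> {..<l} \<rightarrow>\<^sub>E V. X i \<in> R} \<le> card (PiE {..<l} ?B)"
      using V finite_subset[OF R V] by (intro card_mono finite_PiE) auto
    also have "\<dots> = (\<Prod>j<l. card (?B j))" by (simp add: card_PiE)
    also have "\<dots> = card R * (\<Prod>j\<in>{..<l} - {i}. card (?B j))"
      using i by (subst prod.remove[of _ i]) auto
    also have "(\<Prod>j\<in>{..<l} - {i}. card (?B j)) = (\<Prod>j\<in>{..<l} - {i}. card V)"
      by (rule prod.cong) auto
    finally show ?thesis using i by simp
  qed
  have "{X \<in> {..<l} \<rightarrow>\<^sub>E V. \<exists>i<l. X i \<in> R} = (\<Union>i<l. {X \<in> {..<l} \<rightarrow>\<^sub>E V. X i \<in> R})" by auto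
  then have "card {X \<in> {..<l} \<rightarrow>\<^sub>E V. \<exists>i<l. X i \<in> R}
      \<le> (\<Sum>i<l. card {X \<in> {..<l} \<rightarrow>\<^sub>E V. X i \<in> R})"
    by (simp add: card_UN_le)
  also have "\<dots> \<le> (\<Sum>i<l. card R * card V ^ (l - 1))" using one by (intro sum_mono) auto
  finally show ?thesis by simp
qed

text \<open>The union bound lets at most half of the \<open>n ^ l\<close> samples meet
  \<open>R\<close>. Double counting pairs of a sample and a vertex with few hits shows that strictly
  fewer than half of the samples have more than \<open>\<eta> * n\<close> such vertices. Some sample
  avoids both defects.\<close>

lemma ex_good_sample:
  fixes \<gamma> z r \<eta> :: real
  assumes V: "finite V" "V \<noteq> {}"
    and N: "\<And>v. v \<in> V \<Longrightarrow> N v \<subseteq> V" "\<And>v. v \<in> V \<Longrightarrow> real (card (N v)) \<ge> \<gamma> * real (card V)"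
    and z: "0 < z" "z < 1" and r: "0 < r" "1 - \<gamma> + \<gamma> * z ^ m \<le> r * z"
    and R: "R \<subseteq> V" "2 * real l * real (card R) \<le> real (card V)"
    and l: "l \<ge> 1" "r ^ l < \<eta> / 2"
  shows "\<exists>X \<in> {..<l} \<rightarrow>\<^sub>E V. (\<forall>i<l. X i \<notin> R) \<and>
           real (card {v \<in> V. m * card {i. i < l \<and> X i \<in> N v} \<le> l}) \<le> \<eta> * real (card V)"
proof (rule ccontr)
  assume no: "\<not> ?thesis"
  define n where "n = real (card V)"
  have n: "n > 0" using V by (simp add: n_def card_gt_0_iff)
  have \<eta>: "\<eta> > 0" using l(2) r(1) zero_less_power[of r l] by linarith
  let ?P = "{..<l} \<rightarrow>\<^sub>E V"
  let ?bad = "\<lambda>X v. m * card {i. i < l \<and> X i \<in> N v} \<le> l"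
  define H where "H = {X \<in> ?P. \<exists>i<l. X i \<in> R}"
  define M where "M = {X \<in> ?P. \<eta> * n < real (card {v \<in> V. ?bad X v})}"
  have fin: "finite ?P" using V by (intro finite_PiE) auto
  have "?P \<subseteq> H \<union> M" using no by (force simp: H_def M_def n_def)
  then have "card ?P \<le> card (H \<union> M)"
    using fin by (intro card_mono) (auto simp: H_def M_def)
  also have "\<dots> \<le> card H + card M" by (rule card_Un_le)
  finally have "real (card ?P) \<le> real (card H) + real (card M)" by linarith
  then have tot: "n ^ l \<le> real (card H) + real (card M)" by (simp add: card_funcsetE n_def)
  have "real (card H) \<le> real (l * (card R * card V ^ (l - 1)))"
    using card_samples_hitting[OF V(1) R(1) l(1)] unfolding H_def by linarith
  also have "\<dots> = real l * real (card R) * n ^ (l - 1)" by (simp add: n_def)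
  also have "\<dots> \<le> (n / 2) * n ^ (l - 1)"
    using R(2) n by (intro mult_right_mono) (auto simp: n_def)
  also have "\<dots> = n ^ l / 2" using l(1) by (cases l) auto
  finally have H: "real (card H) \<le> n ^ l / 2" .
  have "real (card M) * (\<eta> * n) = (\<Sum>X\<in>M. \<eta> * n)" by simp
  also have "\<dots> \<le> (\<Sum>X\<in>M. real (card {v \<in> V. ?bad X v}))"
    by (rule sum_mono) (auto simp: M_def)
  also have "\<dots> \<le> (\<Sum>X\<in>?P. real (card {v \<in> V. ?bad X v}))"
    using fin by (intro sum_mono2) (auto simp: M_def)
  also have "\<dots> = (\<Sum>X\<in>?P. \<Sum>v\<in>V. if ?bad X v then 1 else 0)"
    using V by (simp add: sum.If_cases Int_def)
  also have "\<dots> = (\<Sum>v\<in>V. \<Sum>X\<in>?P. if ?bad X v then 1 else 0)" by (rule sum.swap)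
  also have "\<dots> = (\<Sum>v\<in>V. real (card {X \<in> ?P. ?bad X v}))"
    using fin by (simp add: sum.If_cases Int_def)
  also have "\<dots> \<le> (\<Sum>v\<in>V. (r * n) ^ l)"
    unfolding n_def by (intro sum_mono card_samples_with_few_hits[OF V(1) _ _ z r(2)] N)
  also have "\<dots> = r ^ l * (n ^ l * n)" by (simp add: n_def power_mult_distrib)
  also have "\<dots> < \<eta> / 2 * (n ^ l * n)" using n l(2) by (intro mult_strict_right_mono) auto
  finally have "real (card M) * (\<eta> * n) < (n ^ l / 2) * (\<eta> * n)" by (simp add: algebra_simps)
  then have "real (card M) < n ^ l / 2" using n \<eta> by (simp add: mult_less_cancel_right)
  with H tot show False by linarith
qed

text \<open>Pruning: as long as some fibre has fewer than \<open>t\<close> members, delete it. Each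
  deletion costs fewer than \<open>t\<close> functions and destroys at least one pair
  \<open>(i, f i)\<close> for good, so the strict inequality between \<open>t\<close> times the
  number of pairs and \<open>card F\<close> is an invariant, and it rules out that the family
  becomes empty.\<close>

lemma ex_subfamily_large_fibres:
  fixes t :: real and F :: "('i \<Rightarrow> 'v) set"
  assumes "finite F" "finite I"
    and "t * real (card {(i, f i) | i f. i \<in> I \<and> f \<in> F}) < real (card F)"
    and "t \<ge> 0"
  shows "\<exists>F'\<subseteq>F. F' \<noteq> {} \<and> (\<forall>i\<in>I. \<forall>f\<in>F'. real (card {g \<in> F'. g i = f i}) \<ge> t)"
  using assms
proof (induction "card F" arbitrary: F rule: less_induct)
  case less
  let ?pairs = "\<lambda>F. {(i, f i) | i f. i \<in> I \<and> f \<in> F}"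
  have pairs: "?pairs F = (\<lambda>(i, f). (i, f i)) ` (I \<times> F)" for F :: "('i \<Rightarrow> 'v) set" by auto
  show ?case
  proof (cases "\<forall>i\<in>I. \<forall>f\<in>F. real (card {g \<in> F. g i = f i}) \<ge> t")
    case True
    moreover have "F \<noteq> {}"
    proof
      assume "F = {}"
      with less.prems(3,4) show False by simp
    qed
    ultimately show ?thesis by blast
  next
    case False
    then obtain i f where if_: "i \<in> I" "f \<in> F" "real (card {g \<in> F. g i = f i}) < t" by force
    define D where "D = {g \<in> F. g i = f i}"
    have D: "D \<subseteq> F" "f \<in> D" "finite D" using less.prems(1) if_ by (auto simp: D_def)
    have finp: "finite (?pairs F)" unfolding pairs using less.prems by auto
    have "?pairs (F - D) \<subseteq> ?pairs F - {(i, f i)}" by (auto simp: D_def)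
    then have "card (?pairs (F - D)) \<le> card (?pairs F - {(i, f i)})"
      using finp by (intro card_mono) auto
    also have "\<dots> = card (?pairs F) - 1" using if_ by (intro card_Diff_singleton) auto
    finally have c1: "card (?pairs (F - D)) \<le> card (?pairs F) - 1" .
    have "card (?pairs F) \<ge> 1"
      using card_gt_0_iff[of "?pairs F"] finp if_(1,2) by fastforce
    with c1 have "real (card (?pairs (F - D))) \<le> real (card (?pairs F)) - 1" by linarith
    then have "t * real (card (?pairs (F - D))) \<le> t * (real (card (?pairs F)) - 1)"
      using less.prems(4) by (rule mult_left_mono)
    also have "\<dots> < real (card F) - real (card D)"
      using less.prems(3) if_(3) by (simp add: algebra_simps D_def)
    also have "\<dots> = real (card (F - D))"
      using D less.prems(1) by (simp add: card_Diff_subset of_nat_diff card_mono)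
    finally have "t * real (card (?pairs (F - D))) < real (card (F - D))" .
    moreover have "card (F - D) < card F"
      using D less.prems(1) by (intro psubset_card_mono) auto
    ultimately obtain F' where "F' \<subseteq> F - D" "F' \<noteq> {}"
      "\<forall>i\<in>I. \<forall>f\<in>F'. real (card {g \<in> F'. g i = f i}) \<ge> t"
      using less.hyps[of "F - D"] less.prems by auto
    then show ?thesis by blast
  qed
qed

section \<open>Walks on the positions of an odd cycle\<close>

definition cyclically_adjacent :: "nat \<Rightarrow> nat \<Rightarrow> nat \<Rightarrow> bool" where
  "cyclically_adjacent m i j \<longleftrightarrow> j = (i + 1) mod m \<or> i = (j + 1) mod m"

text \<open>Go along the odd arc and then oscillate along one edge.\<close>

lemma ex_position_walk_odd_arc:
  assumes "odd m" "m \<ge> 3" "a < m" "odd d" "d \<le> m - 2" "b = (a + d) mod m"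
  shows "\<exists>p. p 0 = a \<and> p (m - 2) = b \<and> (\<forall>i. p i < m) \<and> (\<forall>i. cyclically_adjacent m (p i) (p (Suc i)))"
proof -
  define p where "p i = (if i \<le> d then (a + i) mod m else if even (i - d) then b else (b + 1) mod m)" for i
  have "even (m - 2 - d)" using assms by simp
  then have "p (m - 2) = b" using assms unfolding p_def by (auto dest: le_antisym)
  moreover have "cyclically_adjacent m (p i) (p (Suc i))" for i
  proof (cases "i < d")
    case True
    then show ?thesis by (simp add: p_def cyclically_adjacent_def mod_Suc_eq)
  next
    case False
    then have "p i = (if even (i - d) then b else (b + 1) mod m)"
      using assms(6) by (auto simp: p_def)
    moreover have "p (Suc i) = (if even (i - d) then (b + 1) mod m else b)"
      using False by (auto simp: p_def Suc_diff_le)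
    ultimately show ?thesis by (simp add: cyclically_adjacent_def)
  qed
  moreover have "p i < m" for i using assms by (simp add: p_def)
  ultimately show ?thesis using assms(3) by (intro exI[of _ p]) (simp add: p_def)
qed

text \<open>Since \<open>m\<close> is odd, exactly one of the two arcs between \<open>a\<close> and
  \<open>b\<close> has odd length, and this length differs from the even number
  \<open>m - 1\<close>, so it is at most \<open>m - 2\<close> and has the parity of
  \<open>m - 2\<close>. Depending on the case that arc leads from \<open>a\<close> to
  \<open>b\<close> or from \<open>b\<close> to \<open>a\<close>; the latter walk is
  reversed.\<close>

lemma ex_position_walk:
  assumes "odd m" "m \<ge> 3" "a < m" "b < m" "a \<noteq> b"
  shows "\<exists>p. p 0 = a \<and> p (m - 2) = b \<and> (\<forall>i. p i < m) \<and>
           (\<forall>i < m - 2. cyclically_adjacent m (p i) (p (Suc i)))"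
proof -
  have odd_arc: ?thesis if "odd d" "d < m" "b = (a + d) mod m" for d
  proof -
    have "d \<noteq> m - 1" using that(1) assms(1) by auto
    then have "d \<le> m - 2" using that(2) by linarith
    then show ?thesis using ex_position_walk_odd_arc[OF assms(1-3) that(1) _ that(3)] by auto
  qed
  have odd_arc_back: ?thesis if d: "odd d" "d < m" "a = (b + d) mod m" for d
  proof -
    have "d \<noteq> m - 1" using d(1) assms(1) by auto
    then have "d \<le> m - 2" using d(2) by linarith
    then obtain p where p: "p 0 = b" "p (m - 2) = a" "\<And>i. p i < m"
      "\<And>i. cyclically_adjacent m (p i) (p (Suc i))"
      using ex_position_walk_odd_arc[OF assms(1,2,4) d(1) _ d(3)] by auto
    have "cyclically_adjacent m (p (m - 2 - i)) (p (m - 2 - Suc i))" if "i < m - 2" for i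
      using p(4)[of "m - 2 - Suc i"] that by (auto simp: cyclically_adjacent_def Suc_diff_Suc)
    then show ?thesis using p by (intro exI[of _ "\<lambda>i. p (m - 2 - i)"]) auto
  qed
  consider "a < b" "odd (b - a)" | "a < b" "even (b - a)" | "b < a" "odd (a - b)" | "b < a" "even (a - b)"
    using assms(5) by linarith
  then show ?thesis
  proof cases
    case 1
    then show ?thesis using odd_arc[of "b - a"] assms by auto
  next
    case 2
    then have "odd (m - (b - a))" using assms by simp
    moreover have "b + (m - (b - a)) = a + m" using 2 assms by simp
    ultimately show ?thesis using odd_arc_back[of "m - (b - a)"] 2 assms by auto
  next
    case 3
    then show ?thesis using odd_arc_back[of "a - b"] assms by auto
  next
    case 4
    then have "odd (m - (a - b))" using assms by simp
    moreover have "a + (m - (a - b)) = b + m" using 4 assms by simp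
    ultimately show ?thesis using odd_arc[of "m - (a - b)"] 4 assms by auto
  qed
qed

section \<open>Closed walks from edge-disjoint cycles\<close>

definition nbrs :: "'a graph \<Rightarrow> 'a \<Rightarrow> 'a set" where
  "nbrs G v = {w \<in> verts G. {v, w} \<in> edges G}"

text \<open>Repeated vertices are allowed because the walks that will be constructed oscillate
  between two positions and so need not be injective. The functions are extensional, so that the
  injective ones are exactly the copies of the cycle.\<close>

definition closed_walks :: "'a graph \<Rightarrow> nat \<Rightarrow> (nat \<Rightarrow> 'a) set" where
  "closed_walks G m =
     {w \<in> {0..<m} \<rightarrow>\<^sub>E verts G. \<forall>i<m. {w i, w ((i + 1) mod m)} \<in> edges G}"

lemma finite_closed_walks: "finite_simple_graph G \<Longrightarrow> finite (closed_walks G m)"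
  unfolding closed_walks_def finite_simple_graph_def
  by (intro finite_subset[OF _ finite_PiE[of "{0..<m}" "\<lambda>_. verts G"]]) auto

lemma copies_cycle_graph:
  "copies (cycle_graph m) G = {f \<in> closed_walks G m. inj_on f {0..<m}}"
proof -
  have "(\<forall>e\<in>edges (cycle_graph m). f ` e \<in> edges G) \<longleftrightarrow>
      (\<forall>i<m. {f i, f ((i + 1) mod m)} \<in> edges G)" for f :: "nat \<Rightarrow> 'a"
  proof -
    have "edges (cycle_graph m) = (\<lambda>i. {i, (i + 1) mod m}) ` {..<m}" by (auto simp: cycle_graph_def)
    then show ?thesis by auto
  qed
  then show ?thesis by (auto simp: copies_def closed_walks_def cycle_graph_def)
qed

lemma degree_le_card_nbrs:
  assumes "finite_simple_graph G"
  shows "degree G v \<le> card (nbrs G v)"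
proof -
  have "{e \<in> edges G. v \<in> e} \<subseteq> (\<lambda>w. {v, w}) ` nbrs G v"
  proof
    fix e assume e: "e \<in> {e \<in> edges G. v \<in> e}"
    then have "card e = 2" "e \<subseteq> verts G" using assms by (auto simp: finite_simple_graph_def)
    then obtain a b where "e = {a, b}" by (auto simp: card_2_iff)
    then obtain w where "e = {v, w}" using e by (metis (no_types, lifting) doubleton_eq_iff insertE mem_Collect_eq singletonD)
    then show "e \<in> (\<lambda>w. {v, w}) ` nbrs G v" using e \<open>e \<subseteq> verts G\<close> by (auto simp: nbrs_def)
  qed
  moreover have "finite (nbrs G v)" using assms by (simp add: nbrs_def finite_simple_graph_def)
  ultimately show ?thesis unfolding degree_def by (rule surj_card_le[rotated])
qed

lemma min_degree_le_card_nbrs: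
  assumes "finite_simple_graph G" "v \<in> verts G"
  shows "min_degree G \<le> card (nbrs G v)"
proof -
  have "min_degree G \<le> degree G v"
    using assms unfolding min_degree_def finite_simple_graph_def by (intro Min_le) auto
  then show ?thesis using degree_le_card_nbrs[OF assms(1)] order_trans by blast
qed

text \<open>Two distinct members would share the edge between positions \<open>i\<close> and
  \<open>j\<close>. This is the form in which edge-disjointness is used: among the cycles with a
  given vertex at one position, the vertex at an adjacent position tells them apart.\<close>

lemma edge_disjoint_cycles_eqI:
  assumes C: "edge_disjoint_copies (cycle_graph m) G C" and fg: "f \<in> C" "g \<in> C"
    and ij: "i < m" "j < m" "cyclically_adjacent m i j" and eq: "f i = g i" "f j = g j"
  shows "f = g"
proof (rule ccontr)
  assume "f \<noteq> g"
  then have disj: "copy_edges (cycle_graph m) f \<inter> copy_edges (cycle_graph m) g = {}"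
    using C fg by (auto simp: edge_disjoint_copies_def pairwise_def)
  have "{i, j} \<in> edges (cycle_graph m)"
    using ij unfolding cyclically_adjacent_def cycle_graph_def by (auto simp: insert_commute)
  then have "f ` {i, j} \<in> copy_edges (cycle_graph m) f" "g ` {i, j} \<in> copy_edges (cycle_graph m) g"
    unfolding copy_edges_def by blast+
  with disj eq show False by auto
qed

lemma card_walks_ge:
  fixes t :: real and U :: "nat \<Rightarrow> 'v set"
  assumes fin: "\<And>i. i \<le> L \<Longrightarrow> finite (U i)" and t: "t \<ge> 0" "real (card (U 0)) \<ge> t"
    and ext: "\<And>i v. i < L \<Longrightarrow> v \<in> U i \<Longrightarrow> real (card {w \<in> U (Suc i). E v w}) \<ge> t"
  shows "real (card {f \<in> PiE {..<Suc L} U. \<forall>i<L. E (f i) (f (Suc i))}) \<ge> t ^ Suc L"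
  using fin ext
proof (induction L)
  case 0
  have "card (PiE {..<Suc 0} U) = card (U 0)" by (simp add: card_PiE)
  then show ?case using t by simp
next
  case (Suc L)
  let ?W = "\<lambda>L. {f \<in> PiE {..<Suc L} U. \<forall>i<L. E (f i) (f (Suc i))}"
  let ?S = "SIGMA f:?W L. {w \<in> U (Suc L). E (f L) w}"
  let ?ext = "\<lambda>(f, y). f(Suc L := y)"
  have finW: "finite (?W L)" using Suc.prems(1) by (intro finite_subset[OF _ finite_PiE[of "{..<Suc L}" U]]) auto
  have IH: "real (card (?W L)) \<ge> t ^ Suc L" using Suc by simp
  have "t ^ Suc (Suc L) \<le> real (card (?W L)) * t" using mult_right_mono[OF IH t(1)] by (simp add: mult.commute)
  also have "\<dots> = (\<Sum>f\<in>?W L. t)" by simp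
  also have "\<dots> \<le> (\<Sum>f\<in>?W L. real (card {w \<in> U (Suc L). E (f L) w}))"
    by (intro sum_mono Suc.prems(2)) auto
  also have "\<dots> = real (card ?S)"
    using finW Suc.prems(1) by (subst card_SigmaI) auto
  also have "card ?S = card (?ext ` ?S)"
  proof (rule card_image[symmetric], rule inj_onI, clarify)
    fix f y f' y'
    assume *: "f \<in> PiE {..<Suc L} U" "f' \<in> PiE {..<Suc L} U" "f(Suc L := y) = f'(Suc L := y')"
    have "f i = f' i" for i
      using PiE_arb[OF *(1), of i] PiE_arb[OF *(2), of i] fun_cong[OF *(3), of i]
      by (cases "i = Suc L") auto
    then show "f = f' \<and> y = y'" using fun_cong[OF *(3), of "Suc L"] by auto
  qed
  also have "real (card (?ext ` ?S)) \<le> real (card (?W (Suc L)))"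
  proof (rule of_nat_mono, rule card_mono)
    show "finite (?W (Suc L))" using Suc.prems(1) by (intro finite_subset[OF _ finite_PiE[of "{..<Suc (Suc L)}" U]]) auto
    show "?ext ` ?S \<subseteq> ?W (Suc L)"
    proof clarify
      fix f y assume "f \<in> PiE {..<Suc L} U" "\<forall>i<L. E (f i) (f (Suc i))" "y \<in> U (Suc L)" "E (f L) y"
      then show "f(Suc L := y) \<in> PiE {..<Suc (Suc L)} U \<and>
          (\<forall>i<Suc L. E ((f(Suc L := y)) i) ((f(Suc L := y)) (Suc i)))"
        by (auto simp: PiE_iff extensional_def less_Suc_eq)
    qed
  qed
  finally show ?case .
qed

text \<open>There are at most \<open>m * card (verts G)\<close> pairs of a position and a vertex, so
  the bound on \<open>t\<close> allows pruning \<open>F\<close> until every nonempty fibre has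
  \<open>t\<close> members. By edge-disjointness such a fibre yields \<open>t\<close> different
  vertices at each adjacent position. Following a walk of \<open>m - 2\<close> steps on the
  positions from \<open>a\<close> to \<open>b\<close> therefore gives \<open>t ^ (m - 1)\<close>
  walks on \<open>m - 1\<close> vertices, and \<open>x\<close>, adjacent to all possible first and
  last vertices, closes each of them.\<close>

lemma card_closed_walks_through_common_nbr:
  fixes t :: real
  assumes G: "finite_simple_graph G" and m: "odd m" "m \<ge> 3"
    and F: "edge_disjoint_copies (cycle_graph m) G F" "finite F"
    and ab: "a < m" "b < m" "a \<noteq> b" and x: "x \<in> verts G"
    and xa: "\<And>f. f \<in> F \<Longrightarrow> {x, f a} \<in> edges G" and xb: "\<And>f. f \<in> F \<Longrightarrow> {x, f b} \<in> edges G"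
    and t: "t \<ge> 0" "t * (real m * real (card (verts G))) < real (card F)"
  shows "real (card {w \<in> closed_walks G m. w (m - 1) = x}) \<ge> t ^ (m - 1)"
proof -
  let ?V = "verts G"
  have finV: "finite ?V" using G by (simp add: finite_simple_graph_def)
  have walk: "f \<in> closed_walks G m" if "f \<in> F" for f
    using F(1) that by (auto simp: edge_disjoint_copies_def copies_cycle_graph)
  have fV: "f i \<in> ?V" if "f \<in> F" "i < m" for f i
    using walk[OF that(1)] that(2) by (auto simp: closed_walks_def PiE_iff)
  have "{(i, f i) | i f. i \<in> {0..<m} \<and> f \<in> F} \<subseteq> {0..<m} \<times> ?V" using fV by auto
  then have "card {(i, f i) | i f. i \<in> {0..<m} \<and> f \<in> F} \<le> card ({0..<m} \<times> ?V)"
    using finV by (intro card_mono) auto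
  then have "card {(i, f i) | i f. i \<in> {0..<m} \<and> f \<in> F} \<le> m * card ?V"
    by (simp only: card_cartesian_product card_atLeastLessThan diff_zero)
  then have "real (card {(i, f i) | i f. i \<in> {0..<m} \<and> f \<in> F}) \<le> real (m * card ?V)"
    by (rule of_nat_mono)
  then have "t * real (card {(i, f i) | i f. i \<in> {0..<m} \<and> f \<in> F}) \<le> t * (real m * real (card ?V))"
    using t(1) unfolding of_nat_mult by (rule mult_left_mono)
  with t(2) have "t * real (card {(i, f i) | i f. i \<in> {0..<m} \<and> f \<in> F}) < real (card F)" by linarith
  from ex_subfamily_large_fibres[OF F(2) finite_atLeastLessThan this t(1)] obtain F' where
    F': "F' \<subseteq> F" "F' \<noteq> {}" and
    fibres: "\<forall>i\<in>{0..<m}. \<forall>f\<in>F'. real (card {g \<in> F'. g i = f i}) \<ge> t"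
    by (elim exE conjE)
  have finF': "finite F'" using F' F(2) finite_subset by blast
  define U where "U i = (\<lambda>f. f i) ` F'" for i
  have finU: "finite (U i)" for i using finF' by (simp add: U_def)
  have UV: "U i \<subseteq> ?V" if "i < m" for i using fV F'(1) that by (auto simp: U_def)
  have ext: "real (card {w \<in> U j. {v, w} \<in> edges G}) \<ge> t"
    if ij: "i < m" "j < m" "cyclically_adjacent m i j" and v: "v \<in> U i" for i j v
  proof -
    obtain f where f: "f \<in> F'" "v = f i" using v by (auto simp: U_def)
    let ?D = "{g \<in> F'. g i = f i}"
    have "inj_on (\<lambda>g. g j) ?D"
    proof (rule inj_onI)
      fix g h assume "g \<in> ?D" "h \<in> ?D" "g j = h j"
      then show "g = h" using edge_disjoint_cycles_eqI[OF F(1) _ _ ij, of g h] F'(1) by auto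
    qed
    moreover have "(\<lambda>g. g j) ` ?D \<subseteq> {w \<in> U j. {v, w} \<in> edges G}"
    proof clarify
      fix g assume g: "g \<in> F'" "g i = f i"
      then have "g \<in> closed_walks G m" using walk F'(1) by auto
      then have "{g i, g j} \<in> edges G"
        using ij unfolding closed_walks_def cyclically_adjacent_def by (auto simp: insert_commute)
      then show "g j \<in> U j \<and> {v, g j} \<in> edges G" using f g by (auto simp: U_def)
    qed
    ultimately have "card ?D \<le> card {w \<in> U j. {v, w} \<in> edges G}"
      using finU by (intro card_inj_on_le) auto
    then show ?thesis using bspec[OF bspec[OF fibres, of i] f(1)] ij(1) by simp
  qed
  obtain p where p: "p 0 = a" "p (m - 2) = b" "\<And>i. p i < m"
    "\<And>i. i < m - 2 \<Longrightarrow> cyclically_adjacent m (p i) (p (Suc i))"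
    using ex_position_walk[OF m ab] by blast
  obtain f0 where f0: "f0 \<in> F'" using F'(2) by blast
  \<comment> \<open>The starting set \<open>U a\<close> is large since any vertex occurring at the
    adjacent position \<open>a'\<close> already has \<open>t\<close> neighbours in it.\<close>
  define a' where "a' = (a + 1) mod m"
  have a': "a' < m" "cyclically_adjacent m a' a" using m by (auto simp: a'_def cyclically_adjacent_def)
  have "t \<le> real (card {w \<in> U a. {f0 a', w} \<in> edges G})"
    using ext[OF a'(1) ab(1) a'(2)] f0 by (auto simp: U_def)
  also have "\<dots> \<le> real (card (U a))" using finU by (intro of_nat_mono card_mono) auto
  finally have t0: "real (card (U a)) \<ge> t" .
  let ?W = "{f \<in> PiE {..<Suc (m - 2)} (\<lambda>i. U (p i)). \<forall>i<m - 2. {f i, f (Suc i)} \<in> edges G}"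
  have m1: "Suc (m - 2) = m - 1" using m by simp
  have "t ^ Suc (m - 2) \<le> real (card ?W)"
  proof (rule card_walks_ge)
    show "real (card {w \<in> U (p (Suc i)). {v, w} \<in> edges G}) \<ge> t"
      if "i < m - 2" "v \<in> U (p i)" for i v
      using ext[OF p(3) p(3) p(4)] that by blast
  qed (use finU t t0 p in auto)
  also have "card ?W = card ((\<lambda>f. f(m - 1 := x)) ` ?W)"
  proof (rule card_image[symmetric], rule inj_onI)
    fix f f' assume *: "f \<in> ?W" "f' \<in> ?W" "f(m - 1 := x) = f'(m - 1 := x)"
    have arb: "g (m - 1) = undefined" if "g \<in> ?W" for g
    proof -
      have "g \<in> PiE {..<Suc (m - 2)} (\<lambda>i. U (p i))" using that by blast
      then show ?thesis by (rule PiE_arb) (simp add: m1)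
    qed
    show "f = f'"
    proof
      fix i show "f i = f' i"
        using arb[OF *(1)] arb[OF *(2)] fun_cong[OF *(3), of i] by (cases "i = m - 1") (simp_all only: fun_upd_apply if_False)
    qed
  qed
  also have "real (card ((\<lambda>f. f(m - 1 := x)) ` ?W)) \<le> real (card {w \<in> closed_walks G m. w (m - 1) = x})"
  proof (rule of_nat_mono, rule card_mono)
    show "finite {w \<in> closed_walks G m. w (m - 1) = x}"
      using finite_closed_walks[OF G] by simp
    show "(\<lambda>f. f(m - 1 := x)) ` ?W \<subseteq> {w \<in> closed_walks G m. w (m - 1) = x}"
    proof clarify
      fix f assume f: "f \<in> PiE {..<Suc (m - 2)} (\<lambda>i. U (p i))" and E: "\<forall>i<m - 2. {f i, f (Suc i)} \<in> edges G"
      have fU: "f i \<in> U (p i)" if "i < m - 1" for i using f that m1 by (auto simp: PiE_iff)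
      define w where "w = f(m - 1 := x)"
      have "w \<in> {0..<m} \<rightarrow>\<^sub>E ?V"
      proof (rule PiE_I)
        fix i assume "i \<in> {0..<m}"
        then consider "i = m - 1" | "i < m - 1" by fastforce
        then show "w i \<in> ?V"
        proof cases
          case 2
          then show ?thesis using fU UV[OF p(3)] by (auto simp: w_def)
        qed (simp add: w_def x)
      next
        fix i assume "i \<notin> {0..<m}"
        then have "i \<notin> {..<Suc (m - 2)}" "i \<noteq> m - 1" using m by auto
        then show "w i = undefined" using PiE_arb[OF f] by (simp add: w_def)
      qed
      moreover have "{w i, w ((i + 1) mod m)} \<in> edges G" if i: "i < m" for i
      proof -
        consider "i < m - 2" | "i = m - 2" | "i = m - 1" using i by linarith
        then show ?thesis
        proof cases
          case 1
          then have "Suc i \<noteq> m - 1" "i \<noteq> m - 1" "(i + 1) mod m = Suc i" by auto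
          then show ?thesis using E 1 by (simp add: w_def)
        next
          case 2
          have "f (m - 2) \<in> U b" using fU[of "m - 2"] p(2) m by auto
          then have "{x, f (m - 2)} \<in> edges G" using xb F'(1) by (auto simp: U_def)
          moreover have "(i + 1) mod m = m - 1" using 2 m by simp
          ultimately show ?thesis using 2 m by (simp add: w_def insert_commute)
        next
          case 3
          have "f 0 \<in> U a" using fU[of 0] p(1) m by auto
          then have "{x, f 0} \<in> edges G" using xa F'(1) by (auto simp: U_def)
          moreover have "(i + 1) mod m = 0" using 3 m by simp
          ultimately show ?thesis using 3 m by (simp add: w_def)
        qed
      qed
      ultimately show "f(m - 1 := x) \<in> closed_walks G m \<and> (f(m - 1 := x)) (m - 1) = x"
        by (simp add: closed_walks_def w_def)
    qed
  qed
  finally show ?thesis unfolding m1 .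
qed

text \<open>The next vertex determines the cycle. Consequently a set of \<open>b\<close> exceptional
  vertices spoils at most \<open>m * b * card (verts G)\<close> cycles.\<close>

lemma card_cycles_through_le:
  assumes G: "finite_simple_graph G" and m: "m \<ge> 1"
    and C: "edge_disjoint_copies (cycle_graph m) G C" and i: "i < m"
  shows "card {f \<in> C. f i = v} \<le> card (verts G)"
proof (rule card_inj_on_le[where f = "\<lambda>f. f ((i + 1) mod m)"])
  have "f = g" if "f \<in> C" "g \<in> C" "f i = g i" "f ((i + 1) mod m) = g ((i + 1) mod m)" for f g
    using edge_disjoint_cycles_eqI[OF C that(1,2) i, of "(i + 1) mod m"] that m
    by (simp add: cyclically_adjacent_def)
  then show "inj_on (\<lambda>f. f ((i + 1) mod m)) {f \<in> C. f i = v}" by (auto intro!: inj_onI)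
  show "(\<lambda>f. f ((i + 1) mod m)) ` {f \<in> C. f i = v} \<subseteq> verts G"
    using C m by (auto simp: edge_disjoint_copies_def copies_cycle_graph closed_walks_def PiE_iff)
  show "finite (verts G)" using G by (simp add: finite_simple_graph_def)
qed

text \<open>Pairwise disjoint \<open>y i\<close> would have more than \<open>l\<close> elements in
  total. Applied with \<open>y i\<close> the trace of position \<open>i\<close> on the sample, it
  yields the sampled vertex adjacent to two positions.\<close>

lemma ex_intersecting_pair:
  assumes "\<And>i. i < m \<Longrightarrow> y i \<subseteq> {..<l}" "\<And>i. i < m \<Longrightarrow> l < m * card (y i)" "m \<ge> 1"
  shows "\<exists>a<m. \<exists>b<m. a \<noteq> b \<and> y a \<inter> y b \<noteq> ({}::nat set)"
proof (rule ccontr)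
  assume "\<not> ?thesis"
  then have disj: "\<forall>a\<in>{..<m}. \<forall>b\<in>{..<m}. a \<noteq> b \<longrightarrow> y a \<inter> y b = {}" by auto
  have "m * l < (\<Sum>i<m. m * card (y i))"
    using sum_strict_mono[of "{..<m}" "\<lambda>_. l" "\<lambda>i. m * card (y i)"] assms(2,3) by (auto simp: lessThan_empty_iff)
  also have "\<dots> = m * (\<Sum>i<m. card (y i))" by (simp add: sum_distrib_left)
  also have "(\<Sum>i<m. card (y i)) = card (\<Union>i<m. y i)"
    using disj finite_subset[OF assms(1) finite_lessThan] by (subst card_UN_disjoint) auto
  also have "\<dots> \<le> card {..<l}" using assms(1) by (intro card_mono) auto
  finally show False by simp
qed

text \<open>Let \<open>R\<close> consist of the vertices at which at least
  \<open>\<rho> * n ^ (m - 1)\<close> closed walks end. If \<open>R\<close> were small, a good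
  sample could avoid it, yet the class of cycles with the most frequent traces puts a sampled vertex
  into \<open>R\<close>. So \<open>R\<close> has more than \<open>n / (2 * l)\<close> elements, and
  summing over the last vertex of a walk gives the bound.\<close>

lemma card_closed_walks_ge:
  fixes \<gamma> z r \<epsilon> :: real
  assumes G: "finite_simple_graph G" "verts G \<noteq> {}" and m: "odd m" "m \<ge> 3"
    and deg: "real (min_degree G) \<ge> \<gamma> * real (card (verts G))"
    and C: "edge_disjoint_copies (cycle_graph m) G C" "real (card C) \<ge> \<epsilon> * (real (card (verts G)))\<^sup>2"
    and z: "0 < z" "z < 1" and r: "0 < r" "1 - \<gamma> + \<gamma> * z ^ m \<le> r * z"
    and \<epsilon>: "\<epsilon> > 0" and l: "l \<ge> 1" "r ^ l < \<epsilon> / (4 * real m)"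
  shows "real (card (closed_walks G m))
           \<ge> (\<epsilon> / (4 * real m * (2 ^ l) ^ m)) ^ (m - 1) / (2 * real l) * real (card (verts G)) ^ m"
proof -
  let ?V = "verts G"
  define n where "n = real (card ?V)"
  have finV: "finite ?V" using G by (simp add: finite_simple_graph_def)
  have n: "n > 0" using finV G(2) by (simp add: n_def card_gt_0_iff)
  have fincw: "finite (closed_walks G m)" using finite_closed_walks[OF G(1)] .
  have CW: "C \<subseteq> closed_walks G m" using C(1) by (auto simp: edge_disjoint_copies_def copies_cycle_graph)
  have finC: "finite C" using CW fincw finite_subset by blast
  have CV: "f i \<in> ?V" if "f \<in> C" "i < m" for f i
    using CW that by (auto simp: closed_walks_def PiE_iff)
  define T :: real where "T = (2 ^ l) ^ m"
  have T: "T > 0" by (simp add: T_def)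
  define \<rho> where "\<rho> = (\<epsilon> / (4 * real m * T)) ^ (m - 1)"
  have \<rho>: "\<rho> > 0" using \<epsilon> m T by (simp add: \<rho>_def)
  define R where "R = {x \<in> ?V. real (card {w \<in> closed_walks G m. w (m - 1) = x}) \<ge> \<rho> * n ^ (m - 1)}"
  have finR: "finite R" "R \<subseteq> ?V" using finV by (auto simp: R_def)
  have "2 * real l * real (card R) > n"
  proof (rule ccontr)
    assume "\<not> ?thesis"
    then have small: "2 * real l * real (card R) \<le> real (card ?V)" by (simp add: n_def)
    \<comment> \<open>At most \<open>\<eta> * n\<close> vertices are bad, and they spoil at most
      \<open>m * (\<eta> * n) * n\<close> cycles; this value of \<open>\<eta>\<close> makes that
      half of \<open>\<epsilon> * n ^ 2\<close>.\<close>
    define \<eta> where "\<eta> = \<epsilon> / (2 * real m)"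
    have N: "nbrs G v \<subseteq> ?V" "real (card (nbrs G v)) \<ge> \<gamma> * real (card ?V)" if "v \<in> ?V" for v
      using min_degree_le_card_nbrs[OF G(1) that] deg by (auto simp: nbrs_def)
    have l2: "r ^ l < \<eta> / 2" using l(2) by (simp add: \<eta>_def)
    let ?bad = "\<lambda>X v. m * card {i. i < l \<and> X i \<in> nbrs G v} \<le> l"
    obtain X where X: "X \<in> {..<l} \<rightarrow>\<^sub>E ?V" "\<And>i. i < l \<Longrightarrow> X i \<notin> R"
      "real (card {v \<in> ?V. ?bad X v}) \<le> \<eta> * real (card ?V)"
      using ex_good_sample[where N = "nbrs G", OF finV G(2) N z r finR(2) small l(1) l2] by auto
    define B where "B = {v \<in> ?V. ?bad X v}"
    have finB: "finite B" using finV by (simp add: B_def)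
    define F0 where "F0 = {f \<in> C. \<forall>i<m. f i \<notin> B}"
    have "C - F0 \<subseteq> (\<Union>(i, v) \<in> {..<m} \<times> B. {f \<in> C. f i = v})" by (auto simp: F0_def)
    then have "card (C - F0) \<le> card (\<Union>(i, v) \<in> {..<m} \<times> B. {f \<in> C. f i = v})"
      using finC finB by (intro card_mono) auto
    also have "\<dots> \<le> (\<Sum>p\<in>{..<m} \<times> B. card (case p of (i, v) \<Rightarrow> {f \<in> C. f i = v}))"
      using finB by (intro card_UN_le) auto
    also have "\<dots> \<le> (\<Sum>p\<in>{..<m} \<times> B. card ?V)"
      using card_cycles_through_le[OF G(1) _ C(1)] m by (intro sum_mono) (auto split: prod.splits)
    also have "\<dots> = m * card B * card ?V" by (simp add: card_cartesian_product)
    finally have "real (card (C - F0)) \<le> real (m * card B * card ?V)" by linarith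
    also have "\<dots> = real m * real (card B) * n" by (simp add: n_def)
    also have "\<dots> \<le> real m * (\<eta> * n) * n"
      using X(3) n by (intro mult_right_mono mult_left_mono) (auto simp: B_def n_def)
    also have "\<dots> = \<epsilon> * n\<^sup>2 / 2" using m by (simp add: \<eta>_def power2_eq_square)
    finally have "real (card (C - F0)) \<le> \<epsilon> * n\<^sup>2 / 2" .
    moreover have "card (C - F0) = card C - card F0" "card F0 \<le> card C"
      using finC by (auto simp: F0_def intro!: card_Diff_subset card_mono)
    ultimately have F0: "real (card F0) \<ge> \<epsilon> * n\<^sup>2 / 2" using C(2) by (simp add: n_def of_nat_diff)
    \<comment> \<open>The traces of all positions on the sample. They take at most
      \<open>(2 ^ l) ^ m\<close> values, which is the loss factor \<open>T\<close>.\<close>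
    define type where "type f = (\<lambda>i\<in>{..<m}. {s. s < l \<and> X s \<in> nbrs G (f i)})" for f
    have "\<exists>y\<in>{..<m} \<rightarrow>\<^sub>E Pow {..<l}.
        card F0 \<le> card ({..<m} \<rightarrow>\<^sub>E Pow {..<l}) * card {f \<in> F0. type f = y}"
      by (rule ex_large_fibre)
        (use finC in \<open>auto simp: type_def F0_def PiE_eq_empty_iff intro!: finite_PiE\<close>)
    then obtain y where y: "y \<in> {..<m} \<rightarrow>\<^sub>E Pow {..<l}"
      and large: "card F0 \<le> (2 ^ l) ^ m * card {f \<in> F0. type f = y}"
      by (auto simp: card_funcsetE card_Pow)
    define F1 where "F1 = {f \<in> F0. type f = y}"
    have "real (card F0) \<le> real ((2 ^ l) ^ m * card F1)"
      using large unfolding F1_def by (rule of_nat_mono)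
    then have F1: "\<epsilon> * n\<^sup>2 / 2 \<le> T * real (card F1)" using F0 by (simp add: T_def)
    have "\<epsilon> * n\<^sup>2 / 2 > 0" using \<epsilon> n by simp
    then have "F1 \<noteq> {}" using F1 by auto
    then obtain f1 where f1: "f1 \<in> F1" by blast
    have yi: "y i = {s. s < l \<and> X s \<in> nbrs G (f i)}" if "f \<in> F1" "i < m" for f i
      using that by (auto simp: F1_def type_def)
    have "l < m * card (y i)" if "i < m" for i
    proof -
      have "f1 i \<in> ?V - B" using f1 that CV by (auto simp: F1_def F0_def)
      then show ?thesis unfolding yi[OF f1 that] B_def by auto
    qed
    moreover have ysub: "y i \<subseteq> {..<l}" if "i < m" for i
      using PiE_mem[OF y, of i] that by simp
    ultimately have "\<exists>a<m. \<exists>b<m. a \<noteq> b \<and> y a \<inter> y b \<noteq> {}"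
      using m by (intro ex_intersecting_pair[of m y l]) auto
    then obtain a b s where ab: "a < m" "b < m" "a \<noteq> b" "s \<in> y a" "s \<in> y b" by blast
    have s: "s < l" using ysub ab by blast
    \<comment> \<open>With this \<open>t\<close>, the product \<open>t * (m * n) * T\<close> is
      \<open>\<epsilon> * n ^ 2 / 4\<close>, half of what \<open>T * card F1\<close> is known to
      reach; the spare factor gives the strict inequality needed for pruning.\<close>
    define t where "t = \<epsilon> * n / (4 * real m * T)"
    have "real (card {w \<in> closed_walks G m. w (m - 1) = X s}) \<ge> t ^ (m - 1)"
    proof (rule card_closed_walks_through_common_nbr[OF G(1) m _ _ ab(1-3)])
      show "edge_disjoint_copies (cycle_graph m) G F1"
        using C(1) by (auto simp: edge_disjoint_copies_def F1_def F0_def pairwise_def)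
      show "finite F1" using finC by (simp add: F1_def F0_def)
      show "X s \<in> ?V" using X(1) s by (auto simp: PiE_iff)
      show "{X s, f a} \<in> edges G" if "f \<in> F1" for f
        using yi[OF that ab(1)] ab(4) by (auto simp: nbrs_def insert_commute)
      show "{X s, f b} \<in> edges G" if "f \<in> F1" for f
        using yi[OF that ab(2)] ab(5) by (auto simp: nbrs_def insert_commute)
      show "t \<ge> 0" using \<epsilon> n T by (simp add: t_def)
      have "t * (real m * n) * T = \<epsilon> * n\<^sup>2 / 4" using m T by (simp add: t_def power2_eq_square)
      also have "\<dots> < \<epsilon> * n\<^sup>2 / 2" using \<epsilon> n by simp
      finally have "t * (real m * n) * T < real (card F1) * T" using F1 by (simp add: mult.commute)
      then show "t * (real m * real (card ?V)) < real (card F1)" using T by (simp add: n_def)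
    qed
    moreover have "t ^ (m - 1) = \<rho> * n ^ (m - 1)"
      by (simp add: t_def \<rho>_def power_mult_distrib power_divide)
    ultimately have "X s \<in> R" using X(1) s by (auto simp: R_def PiE_iff)
    then show False using X(2) s by blast
  qed
  then have "\<rho> / (2 * real l) * n ^ m \<le> real (card R) * (\<rho> * n ^ (m - 1))"
  proof -
    assume R: "2 * real l * real (card R) > n"
    have "n / (2 * real l) \<le> real (card R)" using R l(1) by (simp add: field_simps)
    then have "n / (2 * real l) * (\<rho> * n ^ (m - 1)) \<le> real (card R) * (\<rho> * n ^ (m - 1))"
      using \<rho> n by (intro mult_right_mono) auto
    moreover have "n ^ m = n * n ^ (m - 1)" using m by (cases m) auto
    ultimately show ?thesis by (simp add: mult_ac)
  qed
  also have "\<dots> = (\<Sum>x\<in>R. \<rho> * n ^ (m - 1))" by simp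
  also have "\<dots> \<le> (\<Sum>x\<in>R. real (card {w \<in> closed_walks G m. w (m - 1) = x}))"
    by (intro sum_mono) (auto simp: R_def)
  also have "\<dots> \<le> (\<Sum>x\<in>?V. real (card {w \<in> closed_walks G m. w (m - 1) = x}))"
    using finV finR by (intro sum_mono2) auto
  also have "\<dots> = real (card (closed_walks G m))"
  proof -
    have "(\<lambda>w. w (m - 1)) ` closed_walks G m \<subseteq> ?V" using m by (auto simp: closed_walks_def PiE_iff)
    from card_eq_sum_fibres[OF fincw finV this] show ?thesis by simp
  qed
  finally show ?thesis by (simp add: \<rho>_def T_def n_def)
qed

section \<open>From closed walks to copies\<close>

lemma card_non_injective_le:
  assumes "finite V"
  shows "card {f \<in> {0..<m} \<rightarrow>\<^sub>E V. \<not> inj_on f {0..<m}} \<le> m\<^sup>2 * card V ^ (m - 1)"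
proof -
  have one: "card {f \<in> {0..<m} \<rightarrow>\<^sub>E V. f i = f j} \<le> card V ^ (m - 1)" if ij: "i < m" "j < m" "i \<noteq> j" for i j
  proof -
    let ?D = "{f \<in> {0..<m} \<rightarrow>\<^sub>E V. f i = f j}"
    have "inj_on (\<lambda>f. restrict f ({0..<m} - {j})) ?D"
    proof (rule inj_onI)
      fix f g assume fg: "f \<in> ?D" "g \<in> ?D" "restrict f ({0..<m} - {j}) = restrict g ({0..<m} - {j})"
      have eq: "f x = g x" if "x < m" "x \<noteq> j" for x
        using fun_cong[OF fg(3), of x] that by simp
      show "f = g"
      proof (rule PiE_ext[of _ "{0..<m}" "\<lambda>_. V"])
        fix x assume "x \<in> {0..<m}"
        then show "f x = g x" using eq[of x] eq[of i] fg ij by (cases "x = j") auto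
      qed (use fg in auto)
    qed
    moreover have "(\<lambda>f. restrict f ({0..<m} - {j})) ` ?D \<subseteq> ({0..<m} - {j}) \<rightarrow>\<^sub>E V"
      by (auto simp: PiE_iff split: if_splits)
    ultimately have "card ?D \<le> card (({0..<m} - {j}) \<rightarrow>\<^sub>E V)"
      using assms by (intro card_inj_on_le finite_PiE) auto
    also have "\<dots> = card V ^ (m - 1)" using ij by (simp add: card_funcsetE)
    finally show ?thesis .
  qed
  let ?P = "{(i, j). i < m \<and> j < m \<and> i \<noteq> j}"
  have P: "?P \<subseteq> {..<m} \<times> {..<m}" by auto
  have finP: "finite ?P" by (rule finite_subset[OF P]) auto
  have "{f \<in> {0..<m} \<rightarrow>\<^sub>E V. \<not> inj_on f {0..<m}} \<subseteq> (\<Union>(i, j)\<in>?P. {f \<in> {0..<m} \<rightarrow>\<^sub>E V. f i = f j})"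
    by (fastforce simp: inj_on_def)
  then have "card {f \<in> {0..<m} \<rightarrow>\<^sub>E V. \<not> inj_on f {0..<m}}
      \<le> card (\<Union>(i, j)\<in>?P. {f \<in> {0..<m} \<rightarrow>\<^sub>E V. f i = f j})"
    using finP assms by (intro card_mono) (auto intro!: finite_UN_I finite_subset[OF _ finite_PiE[of "{0..<m}" "\<lambda>_. V"]])
  also have "\<dots> \<le> (\<Sum>p\<in>?P. card (case p of (i, j) \<Rightarrow> {f \<in> {0..<m} \<rightarrow>\<^sub>E V. f i = f j}))"
    using finP by (rule card_UN_le)
  also have "\<dots> \<le> (\<Sum>p\<in>?P. card V ^ (m - 1))" using one by (intro sum_mono) auto
  also have "\<dots> = card ?P * card V ^ (m - 1)" by simp
  also have "\<dots> \<le> m\<^sup>2 * card V ^ (m - 1)"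
    using card_mono[OF _ P] by (intro mult_right_mono) (auto simp: power2_eq_square)
  finally show ?thesis .
qed

lemma card_copies_cycle_ge:
  assumes "finite_simple_graph G"
  shows "real (card (copies (cycle_graph m) G))
    \<ge> real (card (closed_walks G m)) - (real m)\<^sup>2 * real (card (verts G)) ^ (m - 1)"
proof -
  have fin: "finite (verts G)" using assms by (simp add: finite_simple_graph_def)
  let ?N = "{f \<in> {0..<m} \<rightarrow>\<^sub>E verts G. \<not> inj_on f {0..<m}}"
  have "finite ?N" using fin by (intro finite_subset[OF _ finite_PiE[of "{0..<m}" "\<lambda>_. verts G"]]) auto
  then have "card (closed_walks G m) \<le> card (copies (cycle_graph m) G \<union> ?N)"
    using finite_closed_walks[OF assms, of m] unfolding copies_cycle_graph
    by (intro card_mono) (auto, auto simp: closed_walks_def)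
  also have "\<dots> \<le> card (copies (cycle_graph m) G) + card ?N" by (rule card_Un_le)
  also have "card ?N \<le> m\<^sup>2 * card (verts G) ^ (m - 1)" by (rule card_non_injective_le[OF fin])
  finally have "card (closed_walks G m)
      \<le> card (copies (cycle_graph m) G) + m\<^sup>2 * card (verts G) ^ (m - 1)" by simp
  then have "real (card (closed_walks G m))
      \<le> real (card (copies (cycle_graph m) G) + m\<^sup>2 * card (verts G) ^ (m - 1))"
    by (rule of_nat_mono)
  then show ?thesis by simp
qed

text \<open>Small graphs are covered by the single copy that is known to exist.\<close>

lemma copies_from_closed_walks:
  fixes \<theta> :: real
  assumes G: "finite_simple_graph G" "verts G \<noteq> {}" and m: "m \<ge> 1"
    and \<theta>: "0 < \<theta>" "\<theta> \<le> 1" "real (card (closed_walks G m)) \<ge> \<theta> * real (card (verts G)) ^ m"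
    and ne: "copies (cycle_graph m) G \<noteq> {}"
  shows "real (card (copies (cycle_graph m) G))
           \<ge> (\<theta> / (2 * (real m)\<^sup>2)) ^ m * real (card (verts G)) ^ m"
proof -
  define n where "n = real (card (verts G))"
  have n: "n > 0" using G by (simp add: n_def card_gt_0_iff finite_simple_graph_def)
  \<comment> \<open>If \<open>c * n \<ge> 1\<close>, the \<open>m ^ 2 * n ^ (m - 1)\<close>
    degenerate walks are at most half of \<open>\<theta> * n ^ m\<close>. Otherwise
    \<open>(c * n) ^ m\<close> is at most \<open>1\<close>, and one copy is enough.\<close>
  define c where "c = \<theta> / (2 * (real m)\<^sup>2)"
  have c: "0 < c" "c \<le> \<theta> / 2" "c \<le> 1"
  proof -
    have "m > 0" "1 \<le> (real m)\<^sup>2" using m by (auto intro: one_le_power)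
    then have "\<theta> / (2 * (real m)\<^sup>2) \<le> \<theta> / 2" using \<theta>(1) by (intro divide_left_mono) auto
    then show c: "0 < c" "c \<le> \<theta> / 2" using \<theta>(1) m by (auto simp: c_def zero_less_divide_iff)
    show "c \<le> 1" using c(2) \<theta>(2) by linarith
  qed
  show ?thesis
  proof (cases "c * n \<ge> 1")
    case True
    have nm: "n ^ m = n * n ^ (m - 1)" using m by (cases m) auto
    have "(real m)\<^sup>2 * n ^ (m - 1) \<le> (real m)\<^sup>2 * (c * n) * n ^ (m - 1)"
      using True n by (intro mult_right_mono) (auto simp: mult_le_cancel_left1)
    also have "\<dots> = \<theta> / 2 * n ^ m" using m nm by (simp add: c_def)
    finally have "\<theta> / 2 * n ^ m \<le> real (card (copies (cycle_graph m) G))"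
      using card_copies_cycle_ge[OF G(1), of m] \<theta>(3) unfolding n_def by linarith
    moreover have "c ^ m * n ^ m \<le> \<theta> / 2 * n ^ m"
    proof (rule mult_right_mono)
      have "c ^ m \<le> c ^ 1" using c m by (intro power_decreasing) auto
      then show "c ^ m \<le> \<theta> / 2" using c by simp
    qed (use n in simp)
    ultimately show ?thesis by (simp add: c_def n_def)
  next
    case False
    have "(c * n) ^ m \<le> 1" using False c n by (intro power_le_one) auto
    moreover have "finite (copies (cycle_graph m) G)"
      using finite_closed_walks[OF G(1)] by (simp add: copies_cycle_graph)
    then have "card (copies (cycle_graph m) G) \<ge> 1" using ne by (simp add: Suc_le_eq card_gt_0_iff)
    ultimately have "(c * n) ^ m \<le> real (card (copies (cycle_graph m) G))" by linarith
    then show ?thesis unfolding c_def n_def power_mult_distrib .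
  qed
qed

text \<open>Take \<open>l = a * j\<close> with \<open>r ^ a < 1 / 2\<close> and \<open>j\<close> the
  least exponent with \<open>y < 2 ^ j\<close>. Minimality gives \<open>2 ^ j \<le> 2 * y\<close>.
  Since \<open>a\<close> depends on \<open>r\<close> alone, the number \<open>2 ^ l\<close> of
  traces is polynomial in \<open>y\<close>.\<close>

lemma ex_sample_size:
  fixes r :: real
  assumes "0 < r" "r < 1"
  shows "\<exists>a. \<forall>y\<ge>1. \<exists>l\<ge>1. r ^ l < 1 / y \<and> 2 ^ l \<le> (2 * y) ^ a"
proof -
  obtain a where a: "r ^ a < 1 / 2" using real_arch_pow_inv[of "1 / 2" r] assms by auto
  then have a0: "a \<noteq> 0" by (intro notI) simp
  have "\<exists>l\<ge>1. r ^ l < 1 / y \<and> 2 ^ l \<le> (2 * y) ^ a" if y: "y \<ge> 1" for y :: real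
  proof -
    obtain j0 where "y < 2 ^ j0" using real_arch_pow[of 2 y] by auto
    define j where "j = (LEAST j. y < 2 ^ j)"
    have j: "y < 2 ^ j" unfolding j_def using \<open>y < 2 ^ j0\<close> by (rule LeastI)
    have j0: "j \<noteq> 0" using j y by (intro notI) simp
    then have "\<not> y < 2 ^ (j - 1)" unfolding j_def by (intro not_less_Least) auto
    moreover have "(2::real) ^ j = 2 * 2 ^ (j - 1)" using j0 by (cases j) auto
    ultimately have j2: "2 ^ j \<le> 2 * y" by linarith
    have "r ^ (a * j) = (r ^ a) ^ j" by (simp add: power_mult)
    also have "\<dots> \<le> (1 / 2) ^ j" using a assms by (intro power_mono) auto
    also have "\<dots> = 1 / 2 ^ j" by (simp add: power_one_over)
    also have "\<dots> < 1 / y" using j y by (intro divide_strict_left_mono) auto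
    finally have "r ^ (a * j) < 1 / y" .
    moreover have "(2::real) ^ (a * j) = (2 ^ j) ^ a" by (simp add: power_mult[symmetric] mult.commute)
    then have "(2::real) ^ (a * j) \<le> (2 * y) ^ a" using power_mono[OF j2, of a] by simp
    moreover have "a * j \<ge> 1" using a0 j0 by (simp add: Suc_le_eq)
    ultimately show ?thesis by blast
  qed
  then show ?thesis by blast
qed

lemma removal_bound_monomial:
  fixes \<gamma> :: real
  assumes m: "odd m" "m \<ge> 3" and \<gamma>: "\<gamma> > 1 / real m" "\<gamma> \<le> 1"
  shows "\<exists>c D. 0 < c \<and> c \<le> 1 \<and>
    (\<forall>\<epsilon>. 0 < \<epsilon> \<and> \<epsilon> \<le> 1 \<longrightarrow> removal_bound \<epsilon> (cycle_graph m) \<gamma> (c * \<epsilon> ^ D))"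
proof -
  have "\<gamma> * real m > 1" using \<gamma> m by (simp add: field_simps)
  then obtain z r where zr: "0 < z" "z < 1" "0 < r" "r < 1" "1 - \<gamma> + \<gamma> * z ^ m \<le> r * z"
    using ex_decreasing_chord \<gamma>(2) by blast
  obtain a where a: "\<And>y. y \<ge> 1 \<Longrightarrow> \<exists>l\<ge>1. r ^ l < 1 / y \<and> 2 ^ l \<le> (2 * y) ^ a"
    using ex_sample_size[OF zr(3,4)] by blast
  \<comment> \<open>The sample size lemma with \<open>y = 4 * m / \<epsilon>\<close> bounds
    \<open>2 ^ l\<close> by \<open>A / \<epsilon> ^ a\<close>. Putting this bound for both
    \<open>2 ^ l\<close> and \<open>l\<close> into the count of closed walks leaves exactly the
    monomial \<open>c1 * \<epsilon> ^ e1\<close>; \<open>c\<close> and the final factor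
    \<open>m\<close> in the exponent come from passing to copies.\<close>
  define A where "A = (8 * real m) ^ a"
  define c1 where "c1 = (1 / (4 * real m * A ^ m)) ^ (m - 1) / (2 * A)"
  define e1 where "e1 = (1 + a * m) * (m - 1) + a"
  define c where "c = (c1 / (2 * (real m)\<^sup>2)) ^ m"
  have A: "A \<ge> 1" unfolding A_def using m by (intro one_le_power) simp
  have c1: "0 < c1" "c1 \<le> 1"
  proof -
    show "0 < c1" using A m by (simp add: c1_def)
    have "1 \<le> 4 * real m * A ^ m" using m one_le_power[OF A, of m] mult_mono[of 1 "4 * real m" 1 "A ^ m"] by simp
    then have "(1 / (4 * real m * A ^ m)) ^ (m - 1) \<le> 1" by (intro power_le_one) (auto simp: divide_le_eq_1)
    then have "(1 / (4 * real m * A ^ m)) ^ (m - 1) \<le> 2 * A" using A by linarith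
    then show "c1 \<le> 1" using A by (simp add: c1_def divide_le_eq_1)
  qed
  have m2: "1 \<le> 2 * (real m)\<^sup>2" using one_le_power[of "real m" 2] m by linarith
  have c: "0 < c" "c \<le> 1"
  proof -
    show "0 < c" using c1 m by (simp add: c_def)
    have "c1 / (2 * (real m)\<^sup>2) \<le> 1" using c1 m2 m by (simp add: divide_le_eq_1)
    then show "c \<le> 1" unfolding c_def using c1 by (intro power_le_one) auto
  qed
  have "removal_bound \<epsilon> (cycle_graph m) \<gamma> (c * \<epsilon> ^ (e1 * m))" if \<epsilon>: "0 < \<epsilon>" "\<epsilon> \<le> 1" for \<epsilon>
    unfolding removal_bound_def
  proof (intro allI impI, elim conjE exE)
    fix G :: "nat graph" and n C
    assume G: "finite_simple_graph G" and n: "card (verts G) = n" "1 \<le> n"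
      and deg: "\<gamma> * real n \<le> real (min_degree G)"
      and C: "edge_disjoint_copies (cycle_graph m) G C" "\<epsilon> * (real n)\<^sup>2 \<le> real (card C)"
    have "4 * real m / \<epsilon> \<ge> 1" using \<epsilon> m by (simp add: field_simps)
    from a[OF this] obtain l where l: "l \<ge> 1" "r ^ l < \<epsilon> / (4 * real m)" "2 ^ l \<le> A / \<epsilon> ^ a"
      by (auto simp: A_def power_divide)
    have ne: "verts G \<noteq> {}" using n by auto
    define \<theta> where "\<theta> = c1 * \<epsilon> ^ e1"
    define Q where "Q = A / \<epsilon> ^ a"
    have lQ: "real l \<le> Q"
    proof -
      have "real l \<le> 2 ^ l" using of_nat_mono[OF less_imp_le[OF less_exp[of l]], where 'a = real] by simp
      then show ?thesis using l(3) unfolding Q_def by linarith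
    qed
    have "\<theta> = (\<epsilon> / (4 * real m * Q ^ m)) ^ (m - 1) / (2 * Q)"
      using A \<epsilon> by (simp add: \<theta>_def c1_def e1_def Q_def power_divide power_add power_mult[symmetric] 
          power_mult_distrib field_simps)
    also have "\<dots> \<le> (\<epsilon> / (4 * real m * (2 ^ l) ^ m)) ^ (m - 1) / (2 * real l)"
    proof (intro frac_le power_mono divide_left_mono mult_left_mono)
      show "(2 ^ l) \<le> Q" using l(3) by (simp add: Q_def)
    qed (use \<epsilon> l(1) lQ m A in \<open>auto simp: Q_def\<close>)
    finally have "\<theta> * real (card (verts G)) ^ m
        \<le> (\<epsilon> / (4 * real m * (2 ^ l) ^ m)) ^ (m - 1) / (2 * real l) * real (card (verts G)) ^ m"
      by (intro mult_right_mono) auto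
    also have "\<dots> \<le> real (card (closed_walks G m))"
      using card_closed_walks_ge[OF G ne m _ C(1) _ zr(1,2,3,5) \<epsilon>(1) l(1,2)] deg C(2) n(1) by simp
    finally have walks: "real (card (closed_walks G m)) \<ge> \<theta> * real (card (verts G)) ^ m" .
    have \<theta>: "0 < \<theta>" "\<theta> \<le> 1" using c1 \<epsilon> by (auto simp: \<theta>_def intro!: mult_le_one power_le_one)
    have "0 < \<epsilon> * (real n)\<^sup>2" using \<epsilon> n by simp
    then have "C \<noteq> {}" using C(2) by auto
    then have "copies (cycle_graph m) G \<noteq> {}" using C(1) by (auto simp: edge_disjoint_copies_def)
    from copies_from_closed_walks[OF G ne _ \<theta> walks this] m
    have "(\<theta> / (2 * (real m)\<^sup>2)) ^ m * real n ^ m \<le> real (card (copies (cycle_graph m) G))"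
      by (simp add: n)
    moreover have "(\<theta> / (2 * (real m)\<^sup>2)) ^ m = c * \<epsilon> ^ (e1 * m)"
      by (simp add: \<theta>_def c_def power_divide power_mult_distrib power_mult)
    moreover have "card (verts (cycle_graph m)) = m" by (simp add: cycle_graph_def)
    ultimately show "c * \<epsilon> ^ (e1 * m) * real n ^ card (verts (cycle_graph m)) \<le> real (card (copies (cycle_graph m) G))"
      by simp
  qed
  with c show ?thesis by blast
qed

text \<open>One \<open>\<mu>\<close> has to serve as factor and as inverse exponent. For
  \<open>\<epsilon> \<le> 1\<close> a smaller \<open>\<mu>\<close> weakens both demands, so it
  suffices to take it below \<open>c\<close> and below \<open>1 / (D + 1)\<close>, where the
  \<open>1\<close> covers \<open>D = 0\<close>.\<close>

lemma polynomial_removal_above: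
  fixes \<gamma> :: real
  assumes m: "odd m" "m \<ge> 3" and \<gamma>: "\<gamma> > 1 / real m" "\<gamma> \<le> 1"
  shows "\<exists>\<mu>>0. \<forall>\<epsilon>. 0 < \<epsilon> \<and> \<epsilon> \<le> 1 \<longrightarrow> removal_delta \<epsilon> (cycle_graph m) \<gamma> \<ge> \<mu> * \<epsilon> powr (1 / \<mu>)"
proof -
  obtain c D where c: "0 < c" "c \<le> 1" and
    bound: "\<And>\<epsilon>. 0 < \<epsilon> \<Longrightarrow> \<epsilon> \<le> 1 \<Longrightarrow> removal_bound \<epsilon> (cycle_graph m) \<gamma> (c * \<epsilon> ^ D)"
    using removal_bound_monomial[OF m \<gamma>] by blast
  define \<mu> where "\<mu> = min c (1 / (real D + 1))"
  have \<mu>: "\<mu> > 0" "\<mu> \<le> c" "\<mu> \<le> 1 / (real D + 1)" using c by (auto simp: \<mu>_def)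
  then have "real D + 1 \<le> 1 / \<mu>" by (simp add: field_simps)
  then have D: "real D \<le> 1 / \<mu>" by linarith
  have "removal_delta \<epsilon> (cycle_graph m) \<gamma> \<ge> \<mu> * \<epsilon> powr (1 / \<mu>)" if \<epsilon>: "0 < \<epsilon>" "\<epsilon> \<le> 1" for \<epsilon>
  proof -
    have "\<mu> * \<epsilon> powr (1 / \<mu>) \<le> c * \<epsilon> powr (real D)"
      using \<mu> D \<epsilon> by (intro mult_mono powr_mono') auto
    also have "\<dots> = c * \<epsilon> ^ D" using \<epsilon> by (simp add: powr_realpow)
    also have "\<dots> \<le> removal_delta \<epsilon> (cycle_graph m) \<gamma>"
      using c \<epsilon> bound[OF \<epsilon>] by (intro removal_delta_is_max(3)) (auto intro!: mult_le_one power_le_one)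
    finally show ?thesis .
  qed
  with \<mu>(1) show ?thesis by blast
qed

section \<open>Sets without nontrivial means\<close>

lemma digits_sum_less:
  fixes x :: "nat \<Rightarrow> nat"
  assumes "\<And>i. i < d \<Longrightarrow> x i < B"
  shows "(\<Sum>i<d. x i * B ^ i) < B ^ d"
  using assms
proof (induction d)
  case (Suc d)
  have "(\<Sum>i<Suc d. x i * B ^ i) < B ^ d + x d * B ^ d" using Suc by simp
  also have "\<dots> = Suc (x d) * B ^ d" by simp
  also have "\<dots> \<le> B * B ^ d" using Suc.prems[of d] by (intro mult_right_mono) auto
  finally show ?case by simp
qed simp

lemma digits_unique:
  fixes x y :: "nat \<Rightarrow> nat"
  assumes "\<And>i. i < d \<Longrightarrow> x i < B" "\<And>i. i < d \<Longrightarrow> y i < B"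
    and "(\<Sum>i<d. x i * B ^ i) = (\<Sum>i<d. y i * B ^ i)" and "i < d"
  shows "x i = y i"
  using assms
proof (induction d arbitrary: i)
  case (Suc d)
  have lt: "(\<Sum>i<d. x i * B ^ i) < B ^ d" "(\<Sum>i<d. y i * B ^ i) < B ^ d"
    by (rule digits_sum_less, rule Suc.prems(1), simp) (rule digits_sum_less, rule Suc.prems(2), simp)
  have eq: "(\<Sum>i<d. x i * B ^ i) + x d * B ^ d = (\<Sum>i<d. y i * B ^ i) + y d * B ^ d"
    using Suc.prems(3) by simp
  have "B ^ d \<noteq> 0" using lt(1) by linarith
  then have "(a + c * B ^ d) div B ^ d = c" if "a < B ^ d" for a c
    by (subst div_mult_self1) (assumption, simp only: div_less[OF that] add_0_right)
  then have "x d = y d" using lt eq by metis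
  moreover from this eq have "(\<Sum>i<d. x i * B ^ i) = (\<Sum>i<d. y i * B ^ i)" by (simp only: add_right_cancel)
  then have "x i = y i" if "i < d" using Suc.IH Suc.prems(1,2) that by (meson less_SucI)
  ultimately show ?case using Suc.prems(4) by (metis less_SucE)
qed simp

text \<open>The squared distances of the points to their mean add up to zero.\<close>

lemma mean_on_sphere:
  fixes x :: "'j \<Rightarrow> nat \<Rightarrow> nat"
  assumes J: "finite J"
    and norm: "\<And>j. j \<in> J \<Longrightarrow> (\<Sum>i<d. (x j i)\<^sup>2) = R" "(\<Sum>i<d. (x0 i)\<^sup>2) = R"
    and mean: "\<And>i. i < d \<Longrightarrow> (\<Sum>j\<in>J. x j i) = card J * x0 i"
    and ji: "j \<in> J" "i < d"
  shows "x j i = x0 i"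
proof -
  have norm': "(\<Sum>i<d. (int (x j i))\<^sup>2) = int R" if "j \<in> J" for j
    using arg_cong[OF norm(1)[OF that], of int] by simp
  have norm0: "(\<Sum>i<d. (int (x0 i))\<^sup>2) = int R"
    using arg_cong[OF norm(2), of int] by simp
  have "(\<Sum>j\<in>J. \<Sum>i<d. int (x j i) * int (x0 i)) = (\<Sum>i<d. (\<Sum>j\<in>J. int (x j i)) * int (x0 i))"
    by (subst sum.swap) (simp add: sum_distrib_right)
  also have "\<dots> = (\<Sum>i<d. int (card J) * (int (x0 i))\<^sup>2)"
  proof (rule sum.cong)
    fix i assume "i \<in> {..<d}"
    then have "(\<Sum>j\<in>J. int (x j i)) = int (card J) * int (x0 i)"
      using arg_cong[OF mean[of i], of int] by simp
    then show "(\<Sum>j\<in>J. int (x j i)) * int (x0 i) = int (card J) * (int (x0 i))\<^sup>2"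
      by (simp add: power2_eq_square)
  qed simp
  also have "\<dots> = int (card J) * int R" unfolding sum_distrib_left[symmetric] norm0 ..
  finally have cross: "(\<Sum>j\<in>J. \<Sum>i<d. int (x j i) * int (x0 i)) = int (card J) * int R" .
  have "(\<Sum>j\<in>J. \<Sum>i<d. (int (x j i) - int (x0 i))\<^sup>2)
      = (\<Sum>j\<in>J. (\<Sum>i<d. (int (x j i))\<^sup>2) + (\<Sum>i<d. (int (x0 i))\<^sup>2)
           - 2 * (\<Sum>i<d. int (x j i) * int (x0 i)))"
    by (simp add: power2_diff sum.distrib sum_subtractf sum_distrib_left mult.assoc)
  also have "\<dots> = (\<Sum>j\<in>J. 2 * int R - 2 * (\<Sum>i<d. int (x j i) * int (x0 i)))"
    by (rule sum.cong) (auto simp: norm' norm0)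
  also have "\<dots> = (\<Sum>j\<in>J. 2 * int R) - 2 * (\<Sum>j\<in>J. \<Sum>i<d. int (x j i) * int (x0 i))"
    by (simp only: sum_subtractf sum_distrib_left)
  also have "\<dots> = 0" unfolding cross by simp
  finally have zero: "(\<Sum>j\<in>J. \<Sum>i<d. (int (x j i) - int (x0 i))\<^sup>2) = 0" .
  then have "(\<Sum>i<d. (int (x j i) - int (x0 i))\<^sup>2) = 0"
    using J ji by (subst (asm) sum_nonneg_eq_0_iff) (auto intro: sum_nonneg)
  then have "(int (x j i) - int (x0 i))\<^sup>2 = 0"
    using ji by (subst (asm) sum_nonneg_eq_0_iff) auto
  then show ?thesis by simp
qed

text \<open>For \<open>h = 2\<close> this says that \<open>S\<close> has no nontrivial three-term
  arithmetic progression. The index set \<open>J\<close> is arbitrary so that later it can be the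
  positions of a cycle with one position removed.\<close>

definition mean_free :: "nat \<Rightarrow> nat set \<Rightarrow> bool" where
  "mean_free h S \<longleftrightarrow> (\<forall>(J::nat set) s. \<forall>s0\<in>S. finite J \<and> card J = h \<and> s ` J \<subseteq> S \<and> (\<Sum>j\<in>J. s j) = h * s0
      \<longrightarrow> (\<forall>j\<in>J. s j = s0))"

text \<open>Behrend's construction: among the \<open>q ^ d\<close> points of a grid, pigeonhole over
  fewer than \<open>d * q ^ 2 + 1\<close> squared norms finds many on one sphere. The points are
  read as digit strings in base \<open>h * q\<close>. An equation between a sum of \<open>h\<close>
  members and \<open>h\<close> times a member then holds in every coordinate, and a point of a
  sphere is the mean of points of that sphere only trivially.\<close>

lemma ex_behrend_set:
  assumes h: "h \<ge> 1" and q: "q \<ge> 1" and d: "d \<ge> 1"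
  shows "\<exists>S\<subseteq>{..<(h * q) ^ d}. q ^ d \<le> d * q\<^sup>2 * card S \<and> mean_free h S"
proof -
  let ?X = "{..<d} \<rightarrow>\<^sub>E {..<q}"
  let ?norm = "\<lambda>x::nat \<Rightarrow> nat. \<Sum>i<d. (x i)\<^sup>2"
  define B where "B = h * q"
  define enc where "enc x = (\<Sum>i<d. x i * B ^ i)" for x :: "nat \<Rightarrow> nat"
  have qB: "q \<le> B" using h by (simp add: B_def)
  have fin: "finite ?X" by (intro finite_PiE) auto
  have "?norm x < d * q\<^sup>2" if "x \<in> ?X" for x
  proof -
    have "?norm x < (\<Sum>i<d. q\<^sup>2)"
      using that d by (intro sum_strict_mono power_strict_mono) (auto simp: PiE_iff lessThan_empty_iff)
    then show ?thesis by simp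
  qed
  then have "\<exists>R\<in>{..<d * q\<^sup>2}. card ?X \<le> card {..<d * q\<^sup>2} * card {x \<in> ?X. ?norm x = R}"
    using fin d q by (intro ex_large_fibre) (auto simp: lessThan_empty_iff)
  then obtain R where R: "q ^ d \<le> d * q\<^sup>2 * card {x \<in> ?X. ?norm x = R}"
    by (auto simp: card_funcsetE)
  define Y where "Y = {x \<in> ?X. ?norm x = R}"
  have Yq: "x i < q" if "x \<in> Y" "i < d" for x i using that by (auto simp: Y_def PiE_iff)
  have "inj_on enc Y"
  proof (rule inj_onI)
    fix x y assume xy: "x \<in> Y" "y \<in> Y" "enc x = enc y"
    have "x i = y i" if "i < d" for i
      using digits_unique[of d x B y i] xy that Yq qB unfolding enc_def by (meson less_le_trans)
    then show "x = y" using xy by (intro PiE_ext[of x "{..<d}" "\<lambda>_. {..<q}"]) (auto simp: Y_def)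
  qed
  then have card: "card (enc ` Y) = card Y" by (rule card_image)
  have sub: "enc ` Y \<subseteq> {..<(h * q) ^ d}"
  proof clarify
    fix x assume "x \<in> Y"
    then have "enc x < B ^ d" unfolding enc_def using Yq qB by (intro digits_sum_less) (meson less_le_trans)
    then show "enc x < (h * q) ^ d" by (simp add: B_def)
  qed
  have "mean_free h (enc ` Y)"
    unfolding mean_free_def
  proof (intro allI ballI impI, elim conjE)
    fix J :: "nat set" and s s0 j
    assume s0: "s0 \<in> enc ` Y" and J: "finite J" "card J = h" and s: "s ` J \<subseteq> enc ` Y"
      and eq: "(\<Sum>j\<in>J. s j) = h * s0" and j: "j \<in> J"
    obtain x0 where x0: "x0 \<in> Y" "s0 = enc x0" using s0 by blast
    have "\<forall>j\<in>J. \<exists>y. y \<in> Y \<and> s j = enc y" using s by blast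
    then obtain x where x: "\<And>j. j \<in> J \<Longrightarrow> x j \<in> Y \<and> s j = enc (x j)" by metis
    have "(\<Sum>i<d. (\<Sum>j\<in>J. x j i) * B ^ i) = (\<Sum>i<d. \<Sum>j\<in>J. x j i * B ^ i)"
      by (simp add: sum_distrib_right)
    also have "\<dots> = (\<Sum>j\<in>J. \<Sum>i<d. x j i * B ^ i)" by (rule sum.swap)
    also have "\<dots> = (\<Sum>j\<in>J. s j)" using x by (intro sum.cong) (auto simp: enc_def)
    also have "\<dots> = (\<Sum>i<d. (h * x0 i) * B ^ i)"
      unfolding eq x0(2) enc_def by (simp add: sum_distrib_left mult.assoc)
    finally have sums: "(\<Sum>i<d. (\<Sum>j\<in>J. x j i) * B ^ i) = (\<Sum>i<d. (h * x0 i) * B ^ i)" .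
    \<comment> \<open>Neither a sum of \<open>h\<close> digits below \<open>q\<close> nor
      \<open>h\<close> times such a digit reaches the base \<open>B = h * q\<close>. So no carries
      occur and digits may be compared one by one.\<close>
    have mean: "(\<Sum>j\<in>J. x j i) = card J * x0 i" if "i < d" for i
    proof -
      have "J \<noteq> {}" using j by blast
      then have "(\<Sum>j\<in>J. x j i') < B" if "i' < d" for i'
        using sum_strict_mono[of J "\<lambda>j. x j i'" "\<lambda>_. q"] J x Yq that by (auto simp: B_def)
      moreover have "h * x0 i' < B" if "i' < d" for i' using Yq[OF x0(1) that] h by (simp add: B_def)
      ultimately show ?thesis using digits_unique[OF _ _ sums that] J(2) by simp
    qed
    have "x j i = x0 i" if "i < d" for i
      by (rule mean_on_sphere[OF J(1) _ _ mean j that]) (use x x0 in \<open>auto simp: Y_def\<close>)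
    then show "s j = s0" using x[OF j] x0(2) by (simp add: enc_def)
  qed
  moreover have "q ^ d \<le> d * q\<^sup>2 * card (enc ` Y)" using R card by (simp add: Y_def)
  ultimately show ?thesis using sub by blast
qed


section \<open>Graphs with few odd cycles\<close>

text \<open>A vertex \<open>v\<close> stands for the point \<open>v div m\<close> in column \<open>v mod m\<close>. Points below \<open>Q\<close> carry the
  Behrend-type cycles; the points of a column at or above \<open>Q\<close> are joined to all lower points of
  that column and to all upper points of the columns next to it, except across the gap between the
  last and the first column. They provide the minimum degree, and since the upper columns form a
  path, they lie on no cycle of length \<open>m\<close>.\<close>

definition step :: "nat \<Rightarrow> nat \<Rightarrow> nat \<Rightarrow> nat \<Rightarrow> bool" where
  "step m s v w \<longleftrightarrow> w mod m = (v mod m + 1) mod m \<and>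
     (if v mod m < m - 1 then w div m = v div m + s else v div m = w div m + (m - 1) * s)"

definition arc :: "nat \<Rightarrow> nat \<Rightarrow> nat set \<Rightarrow> nat \<Rightarrow> nat \<Rightarrow> bool" where
  "arc m Q S v w \<longleftrightarrow>
     v div m < Q \<and> w div m < Q \<and> (\<exists>s\<in>S. step m s v w) \<or>
     Q \<le> v div m \<and> Q \<le> w div m \<and> w mod m = v mod m + 1 \<or>
     v div m < Q \<and> Q \<le> w div m \<and> v mod m = w mod m"

definition behrend_graph :: "nat \<Rightarrow> nat \<Rightarrow> nat \<Rightarrow> nat set \<Rightarrow> nat graph" where
  "behrend_graph m Q T S =
     (let n = m * (Q * (1 + T)) in ({..<n}, {{v, w} | v w. v < n \<and> w < n \<and> arc m Q S v w}))"

lemma verts_behrend_graph [simp]: "verts (behrend_graph m Q T S) = {..<m * (Q * (1 + T))}"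
  by (simp add: behrend_graph_def Let_def)

lemma edge_behrend_graph:
  "{v, w} \<in> edges (behrend_graph m Q T S) \<longleftrightarrow>
     v < m * (Q * (1 + T)) \<and> w < m * (Q * (1 + T)) \<and> (arc m Q S v w \<or> arc m Q S w v)"
  by (auto simp: behrend_graph_def Let_def doubleton_eq_iff)

lemma Suc_mod_neq: "m \<ge> 2 \<Longrightarrow> c < m \<Longrightarrow> (c + 1) mod m \<noteq> c" for c m :: nat
  by (auto simp: mod_Suc)

text \<open>With only two columns, forward and backward would be the same move. From three columns
  on, an edge between neighbouring columns has a definite direction.\<close>

lemma Suc_mod_asym:
  fixes a b m :: nat
  assumes "m \<ge> 3" "a < m" "b < m" "b = (a + 1) mod m"
  shows "a \<noteq> (b + 1) mod m"
  using assms by (auto simp: mod_Suc split: if_splits)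

lemma Suc_mod_inj:
  fixes a b m :: nat
  assumes "a < m" "b < m" "(a + 1) mod m = (b + 1) mod m"
  shows "a = b"
  using assms by (auto simp: mod_Suc split: if_splits)

lemma step_shift_unique: "m \<ge> 2 \<Longrightarrow> step m s v w \<Longrightarrow> step m s' v w \<Longrightarrow> s = s'"
  by (auto simp: step_def split: if_splits)

lemma step_asym: "m \<ge> 3 \<Longrightarrow> step m s v w \<Longrightarrow> \<not> step m s' w v"
  using Suc_mod_asym[of m "v mod m" "w mod m"] by (auto simp: step_def)

lemma nat_eq_div_mod: "a div m = b div m \<Longrightarrow> a mod m = b mod m \<Longrightarrow> a = b" for a b m :: nat
  by (metis div_mult_mod_eq)

lemma step_target_unique: "step m s v w \<Longrightarrow> step m s v w' \<Longrightarrow> w = w'"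
  by (rule nat_eq_div_mod[of _ m]) (auto simp: step_def split: if_splits)

lemma step_source_unique:
  assumes "m \<ge> 1" "step m s v w" "step m s v' w"
  shows "v = v'"
proof (rule nat_eq_div_mod[of _ m])
  show "v mod m = v' mod m"
    using assms Suc_mod_inj[of "v mod m" m "v' mod m"] by (auto simp: step_def)
  then show "v div m = v' div m" using assms by (auto simp: step_def split: if_splits)
qed

lemma arc_neq: "m \<ge> 2 \<Longrightarrow> arc m Q S v w \<Longrightarrow> v \<noteq> w"
  using Suc_mod_neq[of m "v mod m"] by (auto simp: arc_def step_def)

lemma finite_simple_behrend_graph:
  assumes "m \<ge> 2"
  shows "finite_simple_graph (behrend_graph m Q T S)"
  unfolding finite_simple_graph_def
proof (intro conjI ballI)
  fix e assume "e \<in> edges (behrend_graph m Q T S)"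
  then obtain v w where e: "e = {v, w}" "v < m * (Q * (1 + T))" "w < m * (Q * (1 + T))" "arc m Q S v w"
    by (auto simp: behrend_graph_def Let_def)
  then show "e \<subseteq> verts (behrend_graph m Q T S)" by simp
  show "card e = 2" using e arc_neq[OF assms e(4)] by simp
qed simp

lemma card_nbrs_le_degree:
  assumes "finite_simple_graph G"
  shows "card (nbrs G v) \<le> degree G v"
  unfolding degree_def
proof (rule card_inj_on_le[where f = "\<lambda>w. {v, w}"])
  show "inj_on (\<lambda>w. {v, w}) (nbrs G v)" by (auto intro!: inj_onI simp: doubleton_eq_iff)
  show "(\<lambda>w. {v, w}) ` nbrs G v \<subseteq> {e \<in> edges G. v \<in> e}" by (auto simp: nbrs_def)
  have "edges G \<subseteq> Pow (verts G)" "finite (verts G)" using assms by (auto simp: finite_simple_graph_def)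
  then have "finite (edges G)" using finite_subset by blast
  then show "finite {e \<in> edges G. v \<in> e}" by simp
qed

text \<open>Each vertex is joined to all \<open>T * Q\<close> upper points of one column: its own
  for a lower point, the next one for an upper point, the previous one for an upper point of the
  last column. Relative to \<open>n = m * Q * (1 + T)\<close> this approaches \<open>1 / m\<close>
  as \<open>T\<close> grows.\<close>

lemma min_degree_behrend_graph:
  assumes m: "m \<ge> 2" and Q: "Q \<ge> 1"
  shows "min_degree (behrend_graph m Q T S) \<ge> T * Q"
proof -
  let ?G = "behrend_graph m Q T S" and ?L = "Q * (1 + T)"
  have "T * Q \<le> degree ?G v" if v: "v \<in> verts ?G" for v
  proof -
    define c where "c = (if v div m < Q then v mod m else if v mod m + 1 < m then v mod m + 1 else v mod m - 1)"
    have "v mod m < m" using m by simp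
    then have cm: "c < m" by (auto simp: c_def)
    have "card {Q..<?L} \<le> card (nbrs ?G v)"
    proof (rule card_inj_on_le[where f = "\<lambda>a. a * m + c"])
      show "inj_on (\<lambda>a. a * m + c) {Q..<?L}" using m by (auto intro!: inj_onI)
      show "(\<lambda>a. a * m + c) ` {Q..<?L} \<subseteq> nbrs ?G v"
      proof clarify
        fix a assume a: "a \<in> {Q..<?L}"
        have wa: "(a * m + c) div m = a" "(a * m + c) mod m = c" using cm by auto
        have "Suc a * m \<le> ?L * m" using a by (intro mult_right_mono) auto
        then have lt: "a * m + c < m * ?L" using cm by (simp add: mult.commute)
        have "arc m Q S v (a * m + c) \<or> arc m Q S (a * m + c) v"
        proof (cases "v div m < Q")
          case True
          then show ?thesis using a wa by (auto simp: arc_def c_def)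
        next
          case False
          have "v mod m < m" using m by simp
          then show ?thesis using False a wa m unfolding arc_def by (auto simp: c_def)
        qed
        then show "a * m + c \<in> nbrs ?G v" using v lt by (simp add: nbrs_def edge_behrend_graph)
      qed
      show "finite (nbrs ?G v)" by (simp add: nbrs_def)
    qed
    then show ?thesis
      using card_nbrs_le_degree[OF finite_simple_behrend_graph[OF m], of Q T S v] by (simp add: mult.commute)
  qed
  moreover have "verts ?G \<noteq> {}" using m Q by (auto simp: lessThan_empty_iff)
  ultimately show ?thesis unfolding min_degree_def by (subst Min_ge_iff) auto
qed

text \<open>The arithmetic progression \<open>x, x + s, ..., x + (m - 1) * s\<close> with one term
  per column. The edge that closes it goes back by \<open>(m - 1) * s\<close>, which explains the
  exceptional clause of \<open>step\<close> for the last column.\<close>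

definition behrend_cycle :: "nat \<Rightarrow> nat \<Rightarrow> nat \<Rightarrow> nat \<Rightarrow> nat" where
  "behrend_cycle m x s = (\<lambda>i\<in>{0..<m}. (x + i * s) * m + i)"

lemma behrend_cycle_div_mod:
  assumes "i < m"
  shows "behrend_cycle m x s i div m = x + i * s" "behrend_cycle m x s i mod m = i"
  using assms by (auto simp: behrend_cycle_def)

lemma step_behrend_cycle:
  assumes "m \<ge> 2" "i < m"
  shows "step m s (behrend_cycle m x s i) (behrend_cycle m x s ((i + 1) mod m))"
proof -
  have "(i + 1) mod m < m" using assms by simp
  note dm = behrend_cycle_div_mod[OF assms(2)] behrend_cycle_div_mod[OF this]
  show ?thesis unfolding step_def dm using assms by (auto simp: mod_Suc)
qed

text \<open>An edge of such a cycle has a definite direction, its displacement reveals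
  \<open>s\<close>, its column reveals the position, and the two together reveal \<open>x\<close>.
  So different pairs \<open>(x, s)\<close> share no edge.\<close>

lemma behrend_cycles:
  assumes m: "m \<ge> 3" and S: "S \<subseteq> {..<M}"
  defines "C \<equiv> (\<lambda>(x, s). behrend_cycle m x s) ` ({..<M} \<times> S)"
  shows "edge_disjoint_copies (cycle_graph m) (behrend_graph m (m * M) T S) C"
    and "card C = M * card S"
proof -
  let ?G = "behrend_graph m (m * M) T S" and ?c = "behrend_cycle m"
  note divmod = behrend_cycle_div_mod
  show "card C = M * card S"
  proof -
    have "inj_on (\<lambda>(x, s). ?c x s) ({..<M} \<times> S)"
    proof (rule inj_onI, clarify)
      fix x s x' s' assume eq: "?c x s = ?c x' s'"
      have "x = x'" using divmod(1)[of 0 m x s] divmod(1)[of 0 m x' s'] eq m by simp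
      moreover have "x + s = x' + s'" using divmod(1)[of 1 m x s] divmod(1)[of 1 m x' s'] eq m by simp
      ultimately show "x = x' \<and> s = s'" by simp
    qed
    then show ?thesis unfolding C_def by (simp add: card_image card_cartesian_product)
  qed
  have copy: "?c x s \<in> copies (cycle_graph m) ?G" if xs: "x < M" "s \<in> S" for x s
  proof -
    \<comment> \<open>The terms stay below \<open>M + (m - 1) * M\<close>; this is the reason for
      the height \<open>Q = m * M\<close> of the lower part.\<close>
    have low: "x + i * s < m * M" if "i < m" for i
    proof -
      have "s < M" using xs S by auto
      then have "i * s \<le> (m - 1) * M" using that by (intro mult_mono) auto
      then have "x + i * s < M + (m - 1) * M" using xs by simp
      also have "\<dots> = m * M" using m by (cases m) auto
      finally show ?thesis .
    qed
    have lt: "?c x s i < m * (m * M * (1 + T))" if "i < m" for i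
    proof -
      have "?c x s i = (x + i * s) * m + i" using that by (simp add: behrend_cycle_def)
      also have "\<dots> < Suc (x + i * s) * m" using that by simp
      also have "\<dots> \<le> (m * M) * m" using low[OF that] by (intro mult_right_mono) auto
      also have "\<dots> \<le> m * (m * M * (1 + T))" by simp
      finally show ?thesis .
    qed
    have "arc m (m * M) S (?c x s i) (?c x s ((i + 1) mod m))" if "i < m" for i
    proof -
      have "(i + 1) mod m < m" using m by simp
      then have "?c x s i div m < m * M" "?c x s ((i + 1) mod m) div m < m * M"
        using low that by (simp_all only: divmod)
      moreover have "step m s (?c x s i) (?c x s ((i + 1) mod m))"
        using that m by (intro step_behrend_cycle) auto
      ultimately show ?thesis using xs(2) unfolding arc_def by blast
    qed
    then have "\<forall>i<m. {?c x s i, ?c x s ((i + 1) mod m)} \<in> edges ?G"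
      using lt m unfolding edge_behrend_graph by simp
    moreover have "?c x s \<in> {0..<m} \<rightarrow>\<^sub>E verts ?G" using lt by (auto simp: behrend_cycle_def)
    moreover have "inj_on (?c x s) {0..<m}" using divmod(2) by (intro inj_on_inverseI[of _ "\<lambda>v. v mod m"]) simp
    ultimately show ?thesis by (simp add: copies_cycle_graph closed_walks_def)
  qed
  have disjoint: "x = x' \<and> s = s'"
    if e: "e \<in> copy_edges (cycle_graph m) (?c x s)" "e \<in> copy_edges (cycle_graph m) (?c x' s')" for x s x' s' e
  proof -
    obtain i where i: "i < m" "e = {?c x s i, ?c x s ((i + 1) mod m)}"
      using e(1) by (auto simp: copy_edges_def cycle_graph_def)
    obtain j where j: "j < m" "e = {?c x' s' j, ?c x' s' ((j + 1) mod m)}"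
      using e(2) by (auto simp: copy_edges_def cycle_graph_def)
    have st: "step m s (?c x s i) (?c x s ((i + 1) mod m))" "step m s' (?c x' s' j) (?c x' s' ((j + 1) mod m))"
      using i j m by (auto intro!: step_behrend_cycle simp del: add_Suc_right add_0_right One_nat_def)
    have "?c x s i = ?c x' s' j \<and> ?c x s ((i + 1) mod m) = ?c x' s' ((j + 1) mod m) \<or>
        ?c x s i = ?c x' s' ((j + 1) mod m) \<and> ?c x s ((i + 1) mod m) = ?c x' s' j"
      using trans[OF i(2)[symmetric] j(2)] unfolding doubleton_eq_iff .
    then have eq: "?c x s i = ?c x' s' j" "?c x s ((i + 1) mod m) = ?c x' s' ((j + 1) mod m)"
      using st(2) step_asym[OF m st(1)] by auto
    then have "s = s'" using st m by (intro step_shift_unique[of m s _ _ s']) auto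
    moreover have "i = j" using arg_cong[OF eq(1), of "\<lambda>v. v mod m"] divmod(2) i(1) j(1) by simp
    moreover have "x + i * s = x' + j * s'"
      using arg_cong[OF eq(1), of "\<lambda>v. v div m"] divmod(1) i(1) j(1) by simp
    ultimately show ?thesis by simp
  qed
  show "edge_disjoint_copies (cycle_graph m) ?G C"
    unfolding edge_disjoint_copies_def
  proof
    show "C \<subseteq> copies (cycle_graph m) ?G" using copy by (auto simp: C_def)
    show "pairwise (\<lambda>f g. copy_edges (cycle_graph m) f \<inter> copy_edges (cycle_graph m) g = {}) C"
    proof (rule pairwiseI, rule ccontr)
      fix f g assume fg: "f \<in> C" "g \<in> C" "f \<noteq> g"
        and "copy_edges (cycle_graph m) f \<inter> copy_edges (cycle_graph m) g \<noteq> {}"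
      then obtain e where e: "e \<in> copy_edges (cycle_graph m) f" "e \<in> copy_edges (cycle_graph m) g" by blast
      obtain x s x' s' where "f = ?c x s" "g = ?c x' s'" using fg by (auto simp: C_def)
      then show False using disjoint[of e x s x' s'] e fg(3) by simp
    qed
  qed
qed

lemma sum_cyclic_shift:
  fixes g :: "nat \<Rightarrow> 'a::comm_monoid_add"
  assumes "m \<ge> 1"
  shows "(\<Sum>i<m. g ((i + 1) mod m)) = (\<Sum>i<m. g i)"
proof -
  obtain k where k: "m = Suc k" using assms by (cases m) auto
  have "(\<Sum>i<m. g ((i + 1) mod m)) = (\<Sum>i<k. g (Suc i)) + g 0" by (simp add: k)
  also have "\<dots> = (\<Sum>i<m. g i)" unfolding k sum.lessThan_Suc_shift by (simp add: add.commute)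
  finally show ?thesis .
qed

text \<open>Going once around, the columns force exactly one closing step, and the total displacement
  zero then expresses its shift as the mean of the others.\<close>

lemma mean_free_steps_equal:
  assumes S: "mean_free (m - 1) S" and m: "m \<ge> 2"
    and st: "\<And>i. i < m \<Longrightarrow> \<exists>s\<in>S. step m s (v i) (w i)"
    and shift: "\<And>g::nat \<Rightarrow> int. (\<Sum>i<m. g (w i)) = (\<Sum>i<m. g (v i))"
  shows "\<exists>s\<in>S. \<forall>i<m. step m s (v i) (w i)"
proof -
  obtain s where s: "\<And>i. i < m \<Longrightarrow> s i \<in> S \<and> step m (s i) (v i) (w i)" using st by metis
  define Z where "Z = {i\<in>{..<m}. v i mod m = m - 1}"
  have Z: "Z \<subseteq> {..<m}" "finite Z" by (auto simp: Z_def)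
  \<comment> \<open>Leaving the last column lowers the column index by \<open>m - 1\<close> instead
    of raising it by \<open>1\<close>, a correction by \<open>m\<close>. As the total change is
    zero, there is one correction.\<close>
  have col: "int (w i mod m) - int (v i mod m) = 1 - (if i \<in> Z then int m else 0)" if i: "i < m" for i
  proof -
    have "v i mod m < m" using m by simp
    then show ?thesis using s[OF i] i m by (auto simp: step_def Z_def mod_Suc of_nat_diff)
  qed
  have "0 = (\<Sum>i<m. int (w i mod m) - int (v i mod m))"
    using shift[of "\<lambda>x. int (x mod m)"] by (simp add: sum_subtractf)
  also have "\<dots> = (\<Sum>i<m. 1 - (if i \<in> Z then int m else 0))" by (rule sum.cong) (auto simp: col)
  also have "\<dots> = int m - int m * int (card Z)"
    using Z by (simp add: sum_subtractf sum.If_cases Int_absorb1)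
  finally have "int m * int (card Z) = int m" by simp
  then have "card Z = 1" using m by simp
  then obtain i0 where i0: "Z = {i0}" by (auto simp: card_1_singleton_iff)
  have i0m: "i0 < m" using i0 Z by auto
  let ?J = "{..<m} - {i0}"
  have val: "int (w i div m) - int (v i div m) = (if i = i0 then - (int (m - 1) * int (s i)) else int (s i))"
    if i: "i < m" for i
  proof -
    have "v i mod m < m" using m by simp
    moreover have "v i mod m = m - 1 \<longleftrightarrow> i = i0" using i0 i by (auto simp: Z_def)
    ultimately have "v i mod m < m - 1 \<longleftrightarrow> i \<noteq> i0" by linarith
    then have "if i = i0 then v i div m = w i div m + (m - 1) * s i else w i div m = v i div m + s i"
      using s[OF i] by (simp add: step_def split: if_splits)
    then show ?thesis by (simp split: if_splits flip: of_nat_mult)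
  qed
  have "0 = (\<Sum>i<m. int (w i div m) - int (v i div m))"
    using shift[of "\<lambda>x. int (x div m)"] by (simp add: sum_subtractf)
  also have "\<dots> = (\<Sum>i<m. if i = i0 then - (int (m - 1) * int (s i)) else int (s i))"
    by (rule sum.cong) (auto simp: val)
  also have "\<dots> = - (int (m - 1) * int (s i0)) + (\<Sum>i\<in>?J. int (s i))"
    using i0m by (subst sum.remove[of _ i0]) (auto intro!: sum.cong)
  finally have "int (\<Sum>i\<in>?J. s i) = int ((m - 1) * s i0)" by simp
  then have "(\<Sum>i\<in>?J. s i) = (m - 1) * s i0" by (simp only: of_nat_eq_iff)
  moreover have "card ?J = m - 1" using i0m by simp
  moreover have "s ` ?J \<subseteq> S" "s i0 \<in> S" "finite ?J" using s i0m by auto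
  ultimately have "\<forall>i\<in>?J. s i = s i0"
    using S unfolding mean_free_def by blast
  then have "\<forall>i<m. s i = s i0" by auto
  then show ?thesis using s i0m by metis
qed

section \<open>Winding of closed walks around the columns\<close>

lemma arc_columns:
  assumes "m \<ge> 1" "arc m Q S v w"
  shows "(v div m < Q \<longleftrightarrow> w div m < Q) \<and> w mod m = (v mod m + 1) mod m \<or>
    (v div m < Q \<longleftrightarrow> \<not> w div m < Q) \<and> v mod m = w mod m"
proof -
  have "w mod m = (v mod m + 1) mod m" if "w mod m = v mod m + 1"
    using that by (metis mod_mod_trivial)
  then show ?thesis using assms by (auto simp: arc_def step_def)
qed

text \<open>The change of column, lifted from residues modulo \<open>m\<close> to an integer in
  \<open>{- 1, 0, 1}\<close>. Summed along a closed walk it is \<open>m\<close> times the winding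
  number around the columns.\<close>

definition turn :: "nat \<Rightarrow> nat \<Rightarrow> nat \<Rightarrow> int" where
  "turn m v w = (if w mod m = (v mod m + 1) mod m then 1
     else if v mod m = (w mod m + 1) mod m then - 1 else 0)"

lemma turn_dvd:
  assumes m: "m \<ge> 3" and "arc m Q S v w \<or> arc m Q S w v"
  shows "int m dvd int (w mod m) - int (v mod m) - turn m v w"
proof -
  consider "w mod m = (v mod m + 1) mod m" |
    "w mod m \<noteq> (v mod m + 1) mod m" "v mod m = (w mod m + 1) mod m" |
    "w mod m \<noteq> (v mod m + 1) mod m" "v mod m \<noteq> (w mod m + 1) mod m" "v mod m = w mod m"
  proof -
    have "w mod m = (v mod m + 1) mod m \<or> v mod m = (w mod m + 1) mod m \<or> v mod m = w mod m"
      using assms(2) m arc_columns[of m Q S v w] arc_columns[of m Q S w v] by auto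
    then show thesis using that by blast
  qed
  then show ?thesis
  proof cases
    case 1
    have "int m dvd int (v mod m + 1) - int (v mod m + 1) mod int m" by (rule dvd_minus_mod)
    then have "int m dvd int (v mod m + 1) - int (w mod m)" unfolding 1 by (simp only: zmod_int)
    then have "int m dvd - (int (v mod m + 1) - int (w mod m))" by (simp only: dvd_minus_iff)
    moreover have "- (int (v mod m + 1) - int (w mod m)) = int (w mod m) - int (v mod m) - turn m v w"
      using 1 by (simp add: turn_def)
    ultimately show ?thesis by (simp only:)
  next
    case 2
    have "int m dvd int (w mod m + 1) - int (w mod m + 1) mod int m" by (rule dvd_minus_mod)
    then have "int m dvd int (w mod m + 1) - int (v mod m)" unfolding 2(2) by (simp only: zmod_int)
    moreover have "turn m v w = - 1" unfolding turn_def using 2 by (simp only: if_True if_False refl)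
    then have "int (w mod m + 1) - int (v mod m) = int (w mod m) - int (v mod m) - turn m v w" by simp
    ultimately show ?thesis by (simp only:)
  next
    case 3
    have "turn m v w = 0" unfolding turn_def using 3 by (simp only: if_False)
    then show ?thesis using 3(3) by simp
  qed
qed

lemma turn_cases:
  assumes m: "m \<ge> 3" and arcs: "arc m Q S v w \<or> arc m Q S w v"
  shows "(v div m < Q \<longleftrightarrow> w div m < Q) \<and> (turn m v w = 1 \<or> turn m v w = - 1) \<or>
    (v div m < Q \<longleftrightarrow> \<not> w div m < Q) \<and> turn m v w = 0"
proof -
  have m1: "m \<ge> 1" using m by simp
  have turn1: "turn m v w = 1 \<or> turn m v w = - 1"
    if "w mod m = (v mod m + 1) mod m \<or> v mod m = (w mod m + 1) mod m"
    using that by (simp only: turn_def) presburger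
  have turn0: "turn m v w = 0" if "v mod m = w mod m"
    unfolding turn_def that using Suc_mod_neq[of m "w mod m"] m by simp
  show ?thesis
    using arcs arc_columns[OF m1, of Q S v w] arc_columns[OF m1, of Q S w v] turn1 turn0 turn0[OF sym]
    by blast
qed

text \<open>An edge changes either the column by one place or the level between lower and upper
  points, never both. Level changes cancel along a closed walk, so the total turn has the parity of
  its length.\<close>

lemma turn_parity:
  assumes "m \<ge> 3" "arc m Q S v w \<or> arc m Q S w v"
  shows "odd (turn m v w + ((if w div m < Q then 1 else 0) - (if v div m < Q then 1 else 0)))"
    and "turn m v w \<noteq> 0 \<Longrightarrow> v div m < Q \<longleftrightarrow> w div m < Q"
  using turn_cases[OF assms] by (elim disjE conjE; simp)+

lemma odd_sum_odd:
  fixes f :: "'a \<Rightarrow> int"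
  assumes "finite A" "\<And>i. i \<in> A \<Longrightarrow> odd (f i)" "odd (card A)"
  shows "odd (\<Sum>i\<in>A. f i)"
proof -
  have "even (\<Sum>i\<in>A. f i - 1)" using assms by (intro dvd_sum) auto
  then show ?thesis using assms by (simp add: sum_subtractf)
qed

text \<open>An \<open>m\<close>-walk that returns to its column makes a total of \<open>0\<close> or \<open>\<plusminus> m\<close> turns, and \<open>0\<close> is excluded by
  parity since it changes between lower and upper points an even number of times.\<close>

lemma closed_walk_turns:
  assumes m: "odd m" "m \<ge> 3"
    and arcs: "\<And>i. i < m \<Longrightarrow> arc m Q S (f i) (f ((i + 1) mod m)) \<or> arc m Q S (f ((i + 1) mod m)) (f i)"
  shows "(\<forall>i<m. turn m (f i) (f ((i + 1) mod m)) = 1) \<or> (\<forall>i<m. turn m (f i) (f ((i + 1) mod m)) = - 1)"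
proof -
  let ?t = "\<lambda>i. turn m (f i) (f ((i + 1) mod m))"
  let ?b = "\<lambda>v. if v div m < Q then 1 else 0 :: int"
  have m1: "m \<ge> 1" using m by simp
  have b: "(\<Sum>i<m. ?b (f ((i + 1) mod m)) - ?b (f i)) = 0"
    using sum_cyclic_shift[OF m1, of "\<lambda>i. ?b (f i)"] by (simp only: sum_subtractf diff_self)
  have "odd (\<Sum>i<m. ?t i + (?b (f ((i + 1) mod m)) - ?b (f i)))"
    using turn_parity(1)[OF m(2) arcs] m(1) by (intro odd_sum_odd) auto
  then have odd: "odd (\<Sum>i<m. ?t i)" unfolding sum.distrib b by simp
  have c: "(\<Sum>i<m. int (f ((i + 1) mod m) mod m) - int (f i mod m)) = 0"
    using sum_cyclic_shift[OF m1, of "\<lambda>i. int (f i mod m)"] by (simp only: sum_subtractf diff_self)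
  have "int m dvd (\<Sum>i<m. int (f ((i + 1) mod m) mod m) - int (f i mod m) - ?t i)"
    using turn_dvd[OF m(2) arcs] by (intro dvd_sum) auto
  then have dvd: "int m dvd (\<Sum>i<m. ?t i)"
    using c by (simp only: sum_subtractf[of _ ?t] diff_0 dvd_minus_iff)
  have "(\<Sum>i<m. ?t i) \<noteq> 0" using odd by (rule contrapos_nn) simp
  \<comment> \<open>The total is a nonzero multiple of \<open>m\<close> and a sum of
    \<open>m\<close> terms of absolute value at most \<open>1\<close>, so all the terms are extremal
    with the same sign.\<close>
  from dvd_imp_le_int[OF this dvd] have big: "int m \<le> \<bar>\<Sum>i<m. ?t i\<bar>" by (simp only: abs_of_nat)
  have t1: "\<bar>?t i\<bar> \<le> 1" for i by (simp add: turn_def)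
  show ?thesis
  proof (cases "(\<Sum>i<m. ?t i) \<ge> 0")
    case True
    have "(\<Sum>i<m. 1 - ?t i) \<le> 0" using big True by (simp add: sum_subtractf)
    moreover have nonneg: "0 \<le> 1 - ?t i" for i using t1[of i] by linarith
    ultimately have "(\<Sum>i<m. 1 - ?t i) = 0" by (intro antisym sum_nonneg) auto
    then have "\<forall>i\<in>{..<m}. 1 - ?t i = 0" using nonneg by (subst (asm) sum_nonneg_eq_0_iff) auto
    then show ?thesis by auto
  next
    case False
    have "(\<Sum>i<m. 1 + ?t i) \<le> 0" using big False by (simp add: sum.distrib)
    moreover have nonneg: "0 \<le> 1 + ?t i" for i using t1[of i] by linarith
    ultimately have "(\<Sum>i<m. 1 + ?t i) = 0" by (intro antisym sum_nonneg) auto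
    then have "\<forall>i\<in>{..<m}. 1 + ?t i = 0" using nonneg by (subst (asm) sum_nonneg_eq_0_iff) auto
    then have "?t i = - 1" if "i < m" for i using that by (simp add: add_eq_0_iff)
    then show ?thesis by blast
  qed
qed

text \<open>Nonzero turns keep the walk on one level. On the upper level no edge crosses the gap
  between the last and the first column, so the column index would grow by one at every edge and
  could not return. The walk is thus among the lower points, where a forward edge is a
  \<open>step\<close>.\<close>

lemma ex_step_of_uniform_turns:
  assumes m: "m \<ge> 3"
    and arcs: "\<And>i. i < m \<Longrightarrow> arc m Q S (v i) (w i) \<or> arc m Q S (w i) (v i)"
    and turns: "\<And>i. i < m \<Longrightarrow> turn m (v i) (w i) = 1"
    and shift: "\<And>g::nat \<Rightarrow> int. (\<Sum>i<m. g (w i)) = (\<Sum>i<m. g (v i))"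
    and side: "\<And>i j. i < m \<Longrightarrow> j < m \<Longrightarrow> v i div m < Q \<longleftrightarrow> v j div m < Q"
    and i: "i < m"
  shows "\<exists>s\<in>S. step m s (v i) (w i)"
proof -
  have col: "w i mod m = (v i mod m + 1) mod m" if "i < m" for i
    using turns[OF that] by (auto simp: turn_def split: if_splits)
  have asym: "v i mod m \<noteq> (w i mod m + 1) mod m" if "i < m" for i
    using Suc_mod_asym[OF m _ _ col[OF that]] m by auto
  have ws: "v i div m < Q \<longleftrightarrow> w i div m < Q" if "i < m" for i
    using turn_parity(2)[OF m arcs[OF that]] turns[OF that] by simp
  have low: "v i div m < Q"
  proof (rule ccontr)
    assume "\<not> ?thesis"
    then have up: "\<not> v j div m < Q" if "j < m" for j using side[OF i that] by simp
    have "int (w j mod m) = int (v j mod m) + 1" if j: "j < m" for j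
    proof -
      have "w j mod m = v j mod m + 1 \<or> v j mod m = w j mod m + 1"
        using arcs[OF j] up[OF j] ws[OF j] by (auto simp: arc_def)
      moreover have "v j mod m \<noteq> w j mod m + 1"
      proof
        assume eq: "v j mod m = w j mod m + 1"
        then have "w j mod m + 1 < m" using m by (metis mod_less_divisor not_numeral_le_zero gr0I)
        then show False using asym[OF j] eq by simp
      qed
      ultimately show ?thesis by simp
    qed
    then have "(\<Sum>j<m. int (w j mod m)) = (\<Sum>j<m. int (v j mod m) + 1)" by (intro sum.cong) auto
    then show False using shift[of "\<lambda>x. int (x mod m)"] m by (simp add: sum.distrib)
  qed
  have "\<not> step m s (w i) (v i)" for s using asym[OF i] by (simp add: step_def)
  then show ?thesis using arcs[OF i] low ws[OF i] by (auto simp: arc_def)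
qed

lemma turn_swap: "m \<ge> 3 \<Longrightarrow> turn m w v = - turn m v w"
  using Suc_mod_asym[of m "v mod m" "w mod m"] by (auto simp: turn_def)

text \<open>A walk winding backward is treated by exchanging the sources and targets of its edges;
  this is why the lemmas used here speak of two sequences \<open>v\<close> and \<open>w\<close> with
  equal sums instead of one closed walk.\<close>

lemma closed_walk_uniform:
  assumes m: "odd m" "m \<ge> 3" and S: "mean_free (m - 1) S"
    and f: "f \<in> closed_walks (behrend_graph m Q T S) m"
  shows "\<exists>s\<in>S. (\<forall>i<m. step m s (f i) (f ((i + 1) mod m))) \<or> (\<forall>i<m. step m s (f ((i + 1) mod m)) (f i))"
proof -
  have arcs: "arc m Q S (f i) (f ((i + 1) mod m)) \<or> arc m Q S (f ((i + 1) mod m)) (f i)" if "i < m" for i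
    using f that edge_behrend_graph[of "f i" "f ((i + 1) mod m)" m Q T S] unfolding closed_walks_def by blast
  have m1: "m \<ge> 1" and m2: "m \<ge> 2" using m by auto
  have shift: "(\<Sum>i<m. g (f ((i + 1) mod m))) = (\<Sum>i<m. g (f i))" for g :: "nat \<Rightarrow> int"
    by (rule sum_cyclic_shift[OF m1])
  have turns: "(\<forall>i<m. turn m (f i) (f ((i + 1) mod m)) = 1) \<or> (\<forall>i<m. turn m (f i) (f ((i + 1) mod m)) = - 1)"
    using m arcs by (rule closed_walk_turns)
  have side1: "f i div m < Q \<longleftrightarrow> f ((i + 1) mod m) div m < Q" if "i < m" for i
    using turn_parity(2)[OF m(2) arcs[OF that]] turns that by fastforce
  have "f i div m < Q \<longleftrightarrow> f 0 div m < Q" if "i < m" for i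
    using that
  proof (induction i)
    case (Suc i)
    then show ?case using side1[of i] by simp
  qed simp
  then have side: "f i div m < Q \<longleftrightarrow> f j div m < Q" if "i < m" "j < m" for i j using that by blast
  have side': "f ((i + 1) mod m) div m < Q \<longleftrightarrow> f ((j + 1) mod m) div m < Q" if "i < m" "j < m" for i j
    using side m1 by (metis mod_less_divisor less_le_trans zero_less_one)
  from turns show ?thesis
  proof
    assume t: "\<forall>i<m. turn m (f i) (f ((i + 1) mod m)) = 1"
    have "\<exists>s\<in>S. step m s (f i) (f ((i + 1) mod m))" if "i < m" for i
      by (rule ex_step_of_uniform_turns[OF m(2) arcs _ shift side that]) (use t in auto)
    from mean_free_steps_equal[OF S m2 this shift] show ?thesis by blast
  next
    assume t: "\<forall>i<m. turn m (f i) (f ((i + 1) mod m)) = - 1"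
    have "\<exists>s\<in>S. step m s (f ((i + 1) mod m)) (f i)" if "i < m" for i
    proof (rule ex_step_of_uniform_turns[OF m(2) _ _ _ side' that])
      show "turn m (f ((i + 1) mod m)) (f i) = 1" if "i < m" for i
        using t that turn_swap[OF m(2), of "f ((i + 1) mod m)" "f i"] by simp
      show "arc m Q S (f ((i + 1) mod m)) (f i) \<or> arc m Q S (f i) (f ((i + 1) mod m))" if "i < m" for i
        using arcs[OF that] by blast
    qed (rule shift[symmetric])
    from mean_free_steps_equal[OF S m2 this shift[symmetric]] show ?thesis by blast
  qed
qed

text \<open>The first edge of a copy fixes the direction and the common shift, and then each vertex
  determines the next. So a copy is determined by its first two vertices.\<close>

lemma card_copies_behrend_graph:
  assumes m: "odd m" "m \<ge> 3" and S: "mean_free (m - 1) S"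
  shows "card (copies (cycle_graph m) (behrend_graph m Q T S)) \<le> (m * (Q * (1 + T)))\<^sup>2"
proof -
  let ?G = "behrend_graph m Q T S"
  have "card (copies (cycle_graph m) ?G) \<le> card (verts ?G \<times> verts ?G)"
  proof (rule card_inj_on_le[where f = "\<lambda>f. (f 0, f 1)"])
    show "inj_on (\<lambda>f. (f 0, f 1)) (copies (cycle_graph m) ?G)"
    proof (rule inj_onI)
      fix f g assume fg: "f \<in> copies (cycle_graph m) ?G" "g \<in> copies (cycle_graph m) ?G"
        and "(f 0, f 1) = (g 0, g 1)"
      then have eq: "f 0 = g 0" "f 1 = g 1" by auto
      have walks: "f \<in> closed_walks ?G m" "g \<in> closed_walks ?G m" using fg by (auto simp: copies_cycle_graph)
      have steps: "\<exists>s. (\<forall>i. Suc i < m \<longrightarrow> step m s (h i) (h (Suc i))) \<or> (\<forall>i. Suc i < m \<longrightarrow> step m s (h (Suc i)) (h i))"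
        if h: "h \<in> closed_walks ?G m" for h
      proof -
        obtain s where "(\<forall>i<m. step m s (h i) (h ((i + 1) mod m))) \<or> (\<forall>i<m. step m s (h ((i + 1) mod m)) (h i))"
          using closed_walk_uniform[OF m S h] by blast
        moreover have "(i + 1) mod m = Suc i" if "Suc i < m" for i using that by simp
        ultimately show ?thesis by (metis Suc_lessD)
      qed
      obtain s where s: "(\<forall>i. Suc i < m \<longrightarrow> step m s (f i) (f (Suc i))) \<or> (\<forall>i. Suc i < m \<longrightarrow> step m s (f (Suc i)) (f i))"
        using steps[OF walks(1)] by blast
      obtain s' where s': "(\<forall>i. Suc i < m \<longrightarrow> step m s' (g i) (g (Suc i))) \<or> (\<forall>i. Suc i < m \<longrightarrow> step m s' (g (Suc i)) (g i))"
        using steps[OF walks(2)] by blast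
      have one: "Suc 0 < m" using m by simp
      have "f i = g i" if "i < m" for i
        using s
      proof
        assume F: "\<forall>i. Suc i < m \<longrightarrow> step m s (f i) (f (Suc i))"
        then have "step m s (f 0) (f (Suc 0))" using one by blast
        then have "step m s (g 0) (g (Suc 0))" using eq by simp
        then have G: "\<forall>i. Suc i < m \<longrightarrow> step m s' (g i) (g (Suc i))"
          using s' step_asym[OF m(2)] one by blast
        have "s' = s" using step_shift_unique[of m s' "g 0" "g (Suc 0)" s] G \<open>step m s (g 0) (g (Suc 0))\<close> one m by simp
        with that show "f i = g i"
        proof (induction i)
          case (Suc i)
          then show ?case using F G step_target_unique by (metis Suc_lessD)
        qed (simp add: eq)
      next
        assume F: "\<forall>i. Suc i < m \<longrightarrow> step m s (f (Suc i)) (f i)"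
        then have "step m s (f (Suc 0)) (f 0)" using one by blast
        then have "step m s (g (Suc 0)) (g 0)" using eq by simp
        then have G: "\<forall>i. Suc i < m \<longrightarrow> step m s' (g (Suc i)) (g i)"
          using s' step_asym[OF m(2)] one by blast
        have "s' = s" using step_shift_unique[of m s' "g (Suc 0)" "g 0" s] G \<open>step m s (g (Suc 0)) (g 0)\<close> one m by simp
        with that show "f i = g i"
        proof (induction i)
          case (Suc i)
          then show ?case using F G step_source_unique[of m] m by (metis Suc_lessD less_imp_le_nat one less_one linorder_not_less)
        qed (simp add: eq)
      qed
      then show "f = g"
        using walks by (intro PiE_ext[of f "{0..<m}" "\<lambda>_. verts ?G"]) (auto simp: closed_walks_def)
    qed
    show "(\<lambda>f. (f 0, f 1)) ` copies (cycle_graph m) ?G \<subseteq> verts ?G \<times> verts ?G"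
    proof clarify
      fix f assume "f \<in> copies (cycle_graph m) ?G"
      then have "f \<in> {0..<m} \<rightarrow>\<^sub>E verts ?G" by (simp add: copies_cycle_graph closed_walks_def)
      moreover have "0 \<in> {0..<m}" "1 \<in> {0..<m}" using m by auto
      ultimately show "f 0 \<in> verts ?G \<and> f 1 \<in> verts ?G" by (blast dest: PiE_mem)
    qed
  qed simp
  then show ?thesis by (simp only: card_cartesian_product verts_behrend_graph card_lessThan power2_eq_square)
qed

section \<open>The threshold\<close>

text \<open>A polynomial bound applied to the construction would give
  \<open>\<mu> * \<epsilon> powr (1 / \<mu>) * n ^ (m - 2) \<le> 1\<close>. Here
  \<open>\<epsilon>\<close> is at least a constant over \<open>q ^ 2\<close> and
  \<open>n \<ge> q ^ d\<close>, so \<open>q powr d\<close> would be at most a constant times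
  \<open>q powr (2 / \<mu>)\<close>. For \<open>d \<ge> 2 / \<mu> + 1\<close> this bounds
  \<open>q\<close>, which is arbitrary.\<close>

lemma no_polynomial_removal_below:
  fixes \<gamma> \<mu> :: real
  assumes m: "odd m" "m \<ge> 3" and \<gamma>: "\<gamma> < 1 / real m" and \<mu>: "\<mu> > 0"
  shows "\<exists>\<epsilon>. 0 < \<epsilon> \<and> \<epsilon> \<le> 1 \<and> removal_delta \<epsilon> (cycle_graph m) \<gamma> < \<mu> * \<epsilon> powr (1 / \<mu>)"
proof (rule ccontr)
  assume "\<not> ?thesis"
  then have poly: "\<mu> * \<epsilon> powr (1 / \<mu>) \<le> removal_delta \<epsilon> (cycle_graph m) \<gamma>" if "0 < \<epsilon>" "\<epsilon> \<le> 1" for \<epsilon>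
    using that by force
  have gm: "1 - \<gamma> * real m > 0" using \<gamma> m by (simp add: field_simps)
  \<comment> \<open>This is \<open>\<gamma> * m * (1 + T) \<le> T\<close> solved for
    \<open>T\<close>, possible since \<open>\<gamma> * m < 1\<close>. It says that the degree
    \<open>T * Q\<close> reaches \<open>\<gamma> * n\<close>.\<close>
  obtain T :: nat where "\<gamma> * real m / (1 - \<gamma> * real m) \<le> real T" using real_arch_simple by blast
  then have T: "\<gamma> * real m * (1 + real T) \<le> real T" using gm by (simp add: field_simps)
  obtain d :: nat where d: "2 / \<mu> + 1 \<le> real d" using real_arch_simple by blast
  have "2 / \<mu> > 0" using \<mu> by simp
  with d have d1: "d \<ge> 1" by linarith
  define h where "h = m - 1"
  define K where "K = m * m * (1 + T)"
  define D where "D = real K ^ 2 * real h ^ d * real d"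
  have h: "h \<ge> 1" and K: "K \<ge> 1" using m by (auto simp: h_def K_def Suc_le_eq)
  have D: "D > 0" using h K d1 by (simp add: D_def)
  have bound: "real q \<le> D powr (1 / \<mu>) / \<mu>" if q: "q \<ge> 1" for q :: nat
  proof -
    define M where "M = (h * q) ^ d"
    obtain S where S: "S \<subseteq> {..<M}" "q ^ d \<le> d * q\<^sup>2 * card S" "mean_free h S"
      using ex_behrend_set[OF h q d1] unfolding M_def by blast
    have M: "M \<ge> 1" using h q by (simp add: M_def Suc_le_eq)
    define Q where "Q = m * M"
    define n where "n = m * (Q * (1 + T))"
    let ?G = "behrend_graph m Q T S"
    have nKM: "n = K * M" by (simp add: n_def Q_def K_def mult_ac)
    have n1: "n \<ge> 1" using K M by (simp add: nKM Suc_le_eq)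
    have Sle: "card S \<le> M" using card_mono[OF _ S(1)] by simp
    have Spos: "card S > 0"
    proof (rule ccontr)
      assume "\<not> ?thesis"
      then show False using S(2) q by simp
    qed
    define \<epsilon> where "\<epsilon> = real (M * card S) / (real n)\<^sup>2"
    have "M \<le> n" unfolding nKM using K by simp
    with Sle have "M * card S \<le> n * n" by (intro mult_mono) auto
    then have "real (M * card S) \<le> (real n)\<^sup>2" by (metis of_nat_le_iff of_nat_mult power2_eq_square)
    then have \<epsilon>: "0 < \<epsilon>" "\<epsilon> \<le> 1" using M Spos n1 by (auto simp: \<epsilon>_def divide_le_eq_1)
    \<comment> \<open>Here \<open>\<epsilon> = card S / (K ^ 2 * M)\<close> with
      \<open>M = (h * q) ^ d\<close>, and \<open>card S\<close> is at least
      \<open>q ^ d / (d * q ^ 2)\<close>. The powers \<open>q ^ d\<close> cancel, and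
      \<open>D\<close> collects the factors free of \<open>q\<close>.\<close>
    have low: "1 / (D * (real q)\<^sup>2) \<le> \<epsilon>"
    proof -
      have "real (q ^ d) \<le> real (d * q\<^sup>2 * card S)" using S(2) by (rule of_nat_mono)
      then have "real h ^ d * real q ^ d \<le> real h ^ d * (real d * (real q)\<^sup>2 * real (card S))"
        by (intro mult_left_mono) auto
      then have "real M * (real K)\<^sup>2 \<le> real h ^ d * (real d * (real q)\<^sup>2 * real (card S)) * (real K)\<^sup>2"
        unfolding M_def by (intro mult_right_mono) (auto simp: power_mult_distrib)
      then have "real M * (real K)\<^sup>2 \<le> real (card S) * (D * (real q)\<^sup>2)"
        by (simp add: D_def mult_ac)
      moreover have "\<epsilon> = real (card S) / (real M * (real K)\<^sup>2)"
        using M by (simp add: \<epsilon>_def nKM power2_eq_square)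
      moreover have "real M * (real K)\<^sup>2 > 0" "D * (real q)\<^sup>2 > 0" using M K D q by auto
      ultimately show ?thesis by (simp add: frac_le_eq divide_le_eq pos_le_divide_eq mult.commute)
    qed
    have "\<gamma> * real n \<le> real (T * Q)"
    proof -
      have "\<gamma> * real n = (\<gamma> * real m * (1 + real T)) * real Q" by (simp add: n_def algebra_simps)
      also have "\<dots> \<le> real T * real Q" using T by (intro mult_right_mono) auto
      finally show ?thesis by simp
    qed
    also have "\<dots> \<le> real (min_degree ?G)"
    proof (rule of_nat_mono, rule min_degree_behrend_graph)
      show "Q \<ge> 1" using m M by (simp add: Q_def Suc_le_eq)
    qed (use m in simp)
    finally have deg: "\<gamma> * real n \<le> real (min_degree ?G)" .
    obtain C where C: "edge_disjoint_copies (cycle_graph m) ?G C" "card C = M * card S"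
      using behrend_cycles(1)[OF m(2) S(1), of T] behrend_cycles(2)[OF m(2) S(1)] unfolding Q_def by blast
    have eps: "\<epsilon> * (real n)\<^sup>2 \<le> real (card C)" using n1 by (simp add: \<epsilon>_def C(2))
    have card: "card (verts ?G) = n" by (simp add: n_def)
    have simple: "finite_simple_graph ?G" using m by (intro finite_simple_behrend_graph) simp
    have "removal_delta \<epsilon> (cycle_graph m) \<gamma> * real n ^ card (verts (cycle_graph m))
        \<le> real (card (copies (cycle_graph m) ?G))"
      using removal_delta_is_max(2)[of \<epsilon> "cycle_graph m" \<gamma>] simple card n1 deg C(1) eps
      unfolding removal_bound_def by blast
    also have "\<dots> \<le> real (n\<^sup>2)"
      using card_copies_behrend_graph[OF m S(3)[unfolded h_def], of Q T] unfolding n_def by (rule of_nat_mono)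
    finally have "removal_delta \<epsilon> (cycle_graph m) \<gamma> * real n ^ m \<le> (real n)\<^sup>2"
      by (simp add: cycle_graph_def)
    then have "\<mu> * \<epsilon> powr (1 / \<mu>) * real n ^ m \<le> (real n)\<^sup>2"
      using mult_right_mono[OF poly[OF \<epsilon>], of "real n ^ m"] by simp
    moreover have "real n ^ m = real n ^ (m - 2) * (real n)\<^sup>2" 
    proof -
      have "m = m - 2 + 2" using m by simp
      then show ?thesis by (metis power_add)
    qed
    ultimately have "\<mu> * \<epsilon> powr (1 / \<mu>) * real n ^ (m - 2) * (real n)\<^sup>2 \<le> 1 * (real n)\<^sup>2"
      by (simp add: mult.assoc)
    then have le1: "\<mu> * \<epsilon> powr (1 / \<mu>) * real n ^ (m - 2) \<le> 1"
      using n1 by (subst (asm) mult_le_cancel_right) auto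
    have "q ^ d \<le> M" unfolding M_def using h by (intro power_mono) auto
    then have "real q ^ d \<le> real M" by (metis of_nat_le_iff of_nat_power)
    also have "\<dots> \<le> real n" using \<open>M \<le> n\<close> by (rule of_nat_mono)
    also have "\<dots> \<le> real n ^ (m - 2)" using n1 m by (intro self_le_power) auto
    finally have qn: "real q powr real d \<le> real n ^ (m - 2)" using q by (simp add: powr_realpow)
    have "\<mu> * (1 / (D * (real q)\<^sup>2)) powr (1 / \<mu>) * real q powr real d
        \<le> \<mu> * \<epsilon> powr (1 / \<mu>) * real n ^ (m - 2)"
      using low qn \<mu> D q by (intro mult_mono powr_mono2) auto
    also note le1
    finally have "\<mu> * (1 / (D * (real q)\<^sup>2)) powr (1 / \<mu>) * real q powr real d \<le> 1" .
    moreover have "(1 / (D * (real q)\<^sup>2)) powr (1 / \<mu>) = 1 / (D powr (1 / \<mu>) * real q powr (2 / \<mu>))"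
    proof -
      have "(real q)\<^sup>2 powr (1 / \<mu>) = (real q powr 2) powr (1 / \<mu>)" using q by simp
      also have "\<dots> = real q powr (2 / \<mu>)" unfolding powr_powr by simp
      finally show ?thesis using D q by (simp add: powr_divide powr_mult)
    qed
    ultimately have "\<mu> * real q powr real d \<le> D powr (1 / \<mu>) * real q powr (2 / \<mu>)"
      using D q by (simp add: field_simps)
    moreover have "real q powr (2 / \<mu>) * real q \<le> real q powr real d"
    proof -
      have "real q powr (2 / \<mu>) * real q = real q powr (2 / \<mu> + 1)" using q by (simp add: powr_add)
      also have "\<dots> \<le> real q powr real d" using d q by (intro powr_mono) auto
      finally show ?thesis .
    qed
    then have "\<mu> * (real q powr (2 / \<mu>) * real q) \<le> \<mu> * real q powr real d" using \<mu> by simp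
    ultimately have "(\<mu> * real q) * real q powr (2 / \<mu>) \<le> D powr (1 / \<mu>) * real q powr (2 / \<mu>)"
      by (simp add: mult_ac)
    then have "\<mu> * real q \<le> D powr (1 / \<mu>)" using q by simp
    then show ?thesis using \<mu> by (simp add: field_simps)
  qed
  obtain q :: nat where "D powr (1 / \<mu>) / \<mu> < real q" using reals_Archimedean2 by blast
  then show False using bound[of "q + 1"] by simp
qed

theorem theorem1p1:
  fixes k :: nat
  assumes "k \<ge> 1"
  shows "poly_removal_threshold (cycle_graph (2 * k + 1)) = 1 / real (2 * k + 1)"
proof -
  define m where "m = 2 * k + 1"
  have m: "odd m" "m \<ge> 3" using assms by (auto simp: m_def)
  let ?A = "{\<gamma> \<in> {0..1}. \<exists>\<mu>>0. \<forall>\<epsilon>. 0 < \<epsilon> \<and> \<epsilon> \<le> 1 \<longrightarrow>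
      removal_delta \<epsilon> (cycle_graph m) \<gamma> \<ge> \<mu> * \<epsilon> powr (1 / \<mu>)}"
  have above: "\<gamma> \<in> ?A" if "1 / real m < \<gamma>" "\<gamma> \<le> 1" for \<gamma>
  proof -
    have "0 \<le> 1 / real m" by simp
    then have "0 \<le> \<gamma>" using that by linarith
    then show ?thesis using polynomial_removal_above[OF m that] that(2) by simp
  qed
  have below: "1 / real m \<le> \<gamma>" if in_A: "\<gamma> \<in> ?A" for \<gamma>
  proof (rule ccontr)
    assume "\<not> ?thesis"
    then have "\<gamma> < 1 / real m" by simp
    moreover obtain \<mu> where "\<mu> > 0" "\<forall>\<epsilon>. 0 < \<epsilon> \<and> \<epsilon> \<le> 1 \<longrightarrow>
        removal_delta \<epsilon> (cycle_graph m) \<gamma> \<ge> \<mu> * \<epsilon> powr (1 / \<mu>)" using in_A by blast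
    ultimately show False using no_polynomial_removal_below[OF m, of \<gamma> \<mu>] by force
  qed
  have m1: "1 / real m < 1" using m by simp
  have "Inf ?A = 1 / real m"
  proof (rule antisym)
    have "?A \<noteq> {}" using above[OF m1] by blast
    then show "1 / real m \<le> Inf ?A" using below by (rule cInf_greatest)
    show "Inf ?A \<le> 1 / real m"
    \<comment> \<open>Neither half decides the case \<open>\<gamma> = 1 / m\<close>, so the infimum
      is approached through larger \<open>\<gamma>\<close>.\<close>
    proof (rule dense_ge_bounded[OF m1])
      fix \<gamma> assume "1 / real m < \<gamma>" "\<gamma> < 1"
      then have "\<gamma> \<in> ?A" by (intro above) auto
      then show "Inf ?A \<le> \<gamma>" by (rule cInf_lower) (auto intro!: bdd_belowI[of _ 0])
    qed
  qed
  then show ?thesis by (simp add: poly_removal_threshold_def m_def)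
qed

end
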